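(* There is a function of the form $f(d)=d/\mathrm{polylog}(d)$ such that for every $\epsilon>0$, every $(f(d),\epsilon n)$-approximation algorithm for Maximum Independent Set on graphs with $n$ vertices and degree bound $d$ requires $\Omega(n)$ queries.
   Context: An independent set of a graph is a set of vertices no two of which are adjacent; Maximum Independent Set asks for the size $x^*$ of a largest independent set. A value $x$ is an $(\alpha,\beta)$-approximation of $x^*$ if $x^*\leq x\leq \alpha x^*+\beta$. An $(\alpha,\beta)$-approximation algorithm is a randomized algorithm that, given oracle access to a graph $G$ with degree bound $d$, outputs an $(\alpha,\beta)$-approximation of the maximum independent set size with probability at least $2/3$. The oracle, given a vertex $v$ and an index $1\le i\le d$, returns the $i$-th edge incident to $v$ (or a special symbol if none exists); query complexity is the number of oracle calls.
   Formalization: "For every ε>0" is restricted to 0<ε<1/h(d), for a polylogarithmic function h fixed together with f; for large ε the claim is false (with ε≥1, outputting n needs no queries). The constant in Ω(n) may depend on d and ε. *)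

theory Defs
  imports "HOL-Probability.Probability_Mass_Function" "HOL-Library.Landau_Symbols"
begin

text \<open>
  Graphs are finite and simple, with vertex set \<open>{..<n}\<close>; the edge set \<open>E\<close> consists of
  two-element sets of vertices.
\<close>

definition simple_graph :: "nat \<Rightarrow> nat set set \<Rightarrow> bool" where
  "simple_graph n E \<longleftrightarrow> (\<forall>e\<in>E. e \<subseteq> {..<n} \<and> card e = 2)"

definition degree_bound :: "nat \<Rightarrow> nat set set \<Rightarrow> nat \<Rightarrow> bool" where
  "degree_bound n E d \<longleftrightarrow> (\<forall>v<n. card {e \<in> E. v \<in> e} \<le> d)"

definition independent_set :: "nat \<Rightarrow> nat set set \<Rightarrow> nat set \<Rightarrow> bool" where
  "independent_set n E S \<longleftrightarrow> S \<subseteq> {..<n} \<and> (\<forall>u\<in>S. \<forall>v\<in>S. {u, v} \<notin> E)"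

definition max_independent_set :: "nat \<Rightarrow> nat set set \<Rightarrow> nat" where
  "max_independent_set n E = Max (card ` {S. independent_set n E S})"

definition approximation :: "real \<Rightarrow> real \<Rightarrow> real \<Rightarrow> real \<Rightarrow> bool" where
  "approximation \<alpha> \<beta> x_opt x \<longleftrightarrow> x_opt \<le> x \<and> x \<le> \<alpha> * x_opt + \<beta>"

text \<open>
  The bounded-degree model presents a graph together with an ordering of the edges at each
  vertex, chosen adversarially.  For \<open>v \<ge> n\<close> the list is necessarily empty.
\<close>

definition incidence_lists :: "nat set set \<Rightarrow> (nat \<Rightarrow> nat set list) \<Rightarrow> bool" where
  "incidence_lists E inc \<longleftrightarrow> (\<forall>v. distinct (inc v) \<and> set (inc v) = {e \<in> E. v \<in> e})"

definition instances :: "nat \<Rightarrow> nat \<Rightarrow> (nat set set \<times> (nat \<Rightarrow> nat set list)) set" where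
  "instances n d = {(E, inc). simple_graph n E \<and> degree_bound n E d \<and> incidence_lists E inc}"

text \<open>Indices count from 1; \<open>None\<close> is the special symbol for a missing edge.\<close>

definition edge_at :: "(nat \<Rightarrow> nat set list) \<Rightarrow> nat \<Rightarrow> nat \<Rightarrow> nat set option" where
  "edge_at inc v i = (if 1 \<le> i \<and> i \<le> length (inc v) then Some (inc v ! (i - 1)) else None)"

text \<open>
  A deterministic adaptive algorithm (for fixed \<open>n\<close> and \<open>d\<close>) is a decision tree:
  \<open>Query v i k\<close> asks for the \<open>i\<close>-th edge at \<open>v\<close> and continues with \<open>k\<close> applied to the
  answer.  A randomized algorithm is a probability distribution over decision trees.  Computation
  between queries is free and the algorithm may depend non-uniformly on \<open>n\<close> and \<open>d\<close>.
\<close>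

datatype decision_tree =
  Output real
| Query nat nat "nat set option \<Rightarrow> decision_tree"

primrec result :: "(nat \<Rightarrow> nat set list) \<Rightarrow> decision_tree \<Rightarrow> real" where
  "result inc (Output x) = x"
| "result inc (Query v i k) = result inc (k (edge_at inc v i))"

primrec num_queries :: "(nat \<Rightarrow> nat set list) \<Rightarrow> decision_tree \<Rightarrow> nat" where
  "num_queries inc (Output x) = 0"
| "num_queries inc (Query v i k) = Suc (num_queries inc (k (edge_at inc v i)))"

definition approximation_algorithm ::
  "nat \<Rightarrow> nat \<Rightarrow> real \<Rightarrow> real \<Rightarrow> decision_tree pmf \<Rightarrow> bool" where
  "approximation_algorithm n d \<alpha> \<beta> A \<longleftrightarrow>
     (\<forall>(E, inc) \<in> instances n d.
        measure_pmf.prob A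
          {T. approximation \<alpha> \<beta> (real (max_independent_set n E)) (result inc T)} \<ge> 2 / 3)"

text \<open>Worst case over all inputs and all random choices; possibly infinite.\<close>

definition query_complexity :: "nat \<Rightarrow> nat \<Rightarrow> decision_tree pmf \<Rightarrow> enat" where
  "query_complexity n d A =
     (SUP (E, inc) \<in> instances n d. SUP T \<in> set_pmf A. enat (num_queries inc T))"

text \<open>\<open>polylog g\<close> expresses \<open>g(d) = (log d)\<^bsup>O(1)\<^esup>\<close> with \<open>g\<close> positive.\<close>

definition polylog :: "(nat \<Rightarrow> real) \<Rightarrow> bool" where
  "polylog g \<longleftrightarrow> (\<forall>d. g d > 0) \<and> (\<exists>c::nat. g \<in> O(\<lambda>d. ln (real d) ^ c))"

end

theory Submission
  imports Defs
begin

text \<open>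
  Hardness comes from planting.  Take a random sparse constraint system over \<open>\<int>\<^sub>2\<close>: each of \<open>m\<close>
  constraints looks at \<open>k\<close> of about \<open>V\<close> variables and is satisfied by \<open>2\<^sup>r \<approx> k\<close> out of \<open>2\<^sup>k\<close>
  patterns, a shift of a linear code.  The vertices of the graph are the pairs of a constraint and
  a satisfying pattern, and inconsistent pairs are adjacent, so an independent set is a partial
  assignment together with constraints that it satisfies.  If the shifts are planted around one
  assignment, all \<open>m\<close> constraints can be satisfied; if they are uniformly random, then for
  \<open>m = V 2\<^sup>k\<^sup>-\<^sup>r\<close> a union bound over the assignments leaves only \<open>O(V)\<close> of them.  The degree is at
  most \<open>k\<^sup>2 2\<^sup>k\<close>, so the gap \<open>2\<^sup>k\<^sup>-\<^sup>r\<close> is \<open>d / polylog d\<close>.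

  The dual code has distance at least 4.  If the constraint hypergraph is such that every small set
  \<open>S\<close> of constraints sees more than \<open>(k - 2)|S|\<close> variables, the linear map from planted data to
  shifts is onto on every small \<open>S\<close>, hence the planted and the uniform shifts have the same
  marginals on \<open>S\<close>.  As \<open>S\<close> may have linear size, an algorithm with too few queries behaves
  identically on both distributions.
\<close>

subsection \<open>Parity systems and indistinguishability\<close>

lemma even_card_sym_diff:
  assumes "finite A" "finite B"
  shows "odd (card (sym_diff A B \<inter> W)) \<longleftrightarrow> odd (card (A \<inter> W)) \<noteq> odd (card (B \<inter> W))"
proof -
  have 1: "card (A \<inter> W) = card ((A - B) \<inter> W) + card (A \<inter> B \<inter> W)"
    using assms by (subst card_Un_disjoint [symmetric]) (auto intro!: arg_cong [where f = card])
  have 2: "card (B \<inter> W) = card ((B - A) \<inter> W) + card (A \<inter> B \<inter> W)"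
    using assms by (subst card_Un_disjoint [symmetric]) (auto intro!: arg_cong [where f = card])
  have 3: "card (sym_diff A B \<inter> W) = card ((A - B) \<inter> W) + card ((B - A) \<inter> W)"
    using assms by (subst card_Un_disjoint [symmetric]) (auto intro!: arg_cong [where f = card])
  show ?thesis unfolding 1 2 3 by auto
qed

text \<open>By \<open>indep\<close> no nonempty subset of the rows \<open>W \<rho>\<close> sums to
  zero over Z_2, so the rows are linearly independent and every right-hand side is attained.
  Character sums take the place of a rank argument.\<close>

lemma parity_system_solvable:
  fixes W :: "'r \<Rightarrow> 'u set"
  assumes R: "finite R" and U: "finite U"
    and indep: "\<And>Y. Y \<subseteq> R \<Longrightarrow> Y \<noteq> {} \<Longrightarrow> \<exists>u\<in>U. odd (card {\<rho>\<in>Y. u \<in> W \<rho>})"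
  shows "\<exists>w\<subseteq>U. \<forall>\<rho>\<in>R. odd (card (w \<inter> W \<rho>)) \<longleftrightarrow> \<rho> \<in> \<beta>"
proof -
  define s :: "'r \<Rightarrow> real" where "s \<rho> = (if \<rho> \<in> \<beta> then - 1 else 1)" for \<rho>
  define sg :: "'r \<Rightarrow> 'u set \<Rightarrow> real" where "sg \<rho> w = (if odd (card (w \<inter> W \<rho>)) then - 1 else 1)" for \<rho> w
  have zero: "(\<Sum>w\<in>Pow U. \<Prod>\<rho>\<in>Y. sg \<rho> w) = 0" if Y: "Y \<subseteq> R" "Y \<noteq> {}" for Y
  proof -
    obtain u where u: "u \<in> U" "odd (card {\<rho>\<in>Y. u \<in> W \<rho>})" using indep[OF Y] by blast
    have fY: "finite Y" using Y R finite_subset by blast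
    have flip: "sg \<rho> (sym_diff w {u}) = sg \<rho> w * (if u \<in> W \<rho> then - 1 else 1)" if "w \<subseteq> U" for \<rho> w
    proof -
      have "finite w" using that U finite_subset by blast
      then have "odd (card (sym_diff w {u} \<inter> W \<rho>)) \<longleftrightarrow> odd (card (w \<inter> W \<rho>)) \<noteq> (u \<in> W \<rho>)"
        by (subst even_card_sym_diff) (auto simp: Int_insert_left)
      then show ?thesis unfolding sg_def by auto
    qed
    have pr: "(\<Prod>\<rho>\<in>Y. if u \<in> W \<rho> then - 1 else (1::real)) = - 1"
    proof -
      have "(\<Prod>\<rho>\<in>Y. if u \<in> W \<rho> then - 1 else (1::real)) = (\<Prod>\<rho>\<in>{\<rho>\<in>Y. u \<in> W \<rho>}. - 1)"
        by (simp only: prod.inter_filter[OF fY])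
      also have "\<dots> = - 1" using u(2) by simp
      finally show ?thesis .
    qed
    \<comment> \<open>Toggling \<open>u\<close> is an involution on \<open>Pow U\<close> that
      reverses the sign of the product, since \<open>u\<close> lies in an odd number of the rows in
      \<open>Y\<close>.\<close>
    have "(\<Sum>w\<in>Pow U. \<Prod>\<rho>\<in>Y. sg \<rho> w) = (\<Sum>w\<in>Pow U. \<Prod>\<rho>\<in>Y. sg \<rho> (sym_diff w {u}))"
      by (rule sum.reindex_bij_witness[where i = "\<lambda>w. sym_diff w {u}" and j = "\<lambda>w. sym_diff w {u}"])
         (use u in \<open>auto simp: insert_absorb intro!: prod.cong arg_cong[where f = "sg _"]\<close>)
    also have "\<dots> = (\<Sum>w\<in>Pow U. - (\<Prod>\<rho>\<in>Y. sg \<rho> w))"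
      by (rule sum.cong) (auto simp: flip prod.distrib pr)
    finally show ?thesis by (simp add: sum_negf)
  qed
  \<comment> \<open>Count the solutions by expanding the product of the characters of the equations.\<close>
  have "(\<Sum>w\<in>Pow U. \<Prod>\<rho>\<in>R. s \<rho> * sg \<rho> w + 1) = (\<Sum>w\<in>Pow U. \<Sum>Y\<in>Pow R. (\<Prod>\<rho>\<in>Y. s \<rho> * sg \<rho> w))"
    by (simp add: prod_add[OF R])
  also have "\<dots> = (\<Sum>Y\<in>Pow R. (\<Prod>\<rho>\<in>Y. s \<rho>) * (\<Sum>w\<in>Pow U. \<Prod>\<rho>\<in>Y. sg \<rho> w))"
    by (subst sum.swap) (simp add: prod.distrib sum_distrib_left)
  also have "\<dots> = (\<Sum>Y\<in>Pow R. if Y = {} then real (card (Pow U)) else 0)"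
    by (rule sum.cong) (auto simp: zero)
  also have "\<dots> > 0" using R U by (simp add: card_Pow)
  finally obtain w where w: "w \<subseteq> U" "(\<Prod>\<rho>\<in>R. s \<rho> * sg \<rho> w + 1) \<noteq> 0"
    by (metis (no_types, lifting) PowD less_irrefl sum.neutral)
  have "odd (card (w \<inter> W \<rho>)) \<longleftrightarrow> \<rho> \<in> \<beta>" if "\<rho> \<in> R" for \<rho>
  proof -
    have "s \<rho> * sg \<rho> w + 1 \<noteq> 0" using w(2) that R by (meson prod_zero_iff)
    then show ?thesis unfolding s_def sg_def by (auto split: if_splits)
  qed
  then show ?thesis using w(1) by blast
qed

text \<open>Induction on the tree, with \<open>\<phi>\<close> in the role of the indicator of the
  answers seen so far, which depends only on the revealed coordinates \<open>S\<close>. A query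
  reveals at most \<open>t\<close> more; at a leaf the output is constant and \<open>local\<close>
  applies. The budget \<open>few\<close> is demanded only where \<open>\<phi>\<close> is nonzero,
  that is, for inputs that reach the current node.\<close>

lemma decision_tree_indistinguishable:
  fixes \<Phi> :: "'w \<Rightarrow> 'j \<Rightarrow> 'b" and inc :: "('j \<Rightarrow> 'b) \<Rightarrow> nat \<Rightarrow> nat set list" and \<phi> :: "('j \<Rightarrow> 'b) \<Rightarrow> real"
  assumes P: "finite P" and Q: "finite Q" and \<Phi>: "\<And>w. w \<in> P \<Longrightarrow> \<Phi> w \<in> Q"
    and local: "\<And>S \<phi>. finite S \<Longrightarrow> card S \<le> q \<Longrightarrow>
      (\<And>b b'. (\<And>j. j \<in> S \<Longrightarrow> b j = b' j) \<Longrightarrow> \<phi> b = \<phi> b') \<Longrightarrow>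
      (\<Sum>w\<in>P. \<phi> (\<Phi> w)) * real (card Q) = (\<Sum>b\<in>Q. \<phi> b :: real) * real (card P)"
    and N: "\<And>u. finite (N u)" "\<And>u. card (N u) \<le> t"
    and inc: "\<And>u b b'. (\<And>j. j \<in> N u \<Longrightarrow> b j = b' j) \<Longrightarrow> inc b u = inc b' u"
    and S: "finite S" and \<phi>: "\<And>b b'. (\<And>j. j \<in> S \<Longrightarrow> b j = b' j) \<Longrightarrow> \<phi> b = \<phi> b'"
    and few: "\<And>b. b \<in> Q \<Longrightarrow> \<phi> b \<noteq> 0 \<Longrightarrow> card S + t * num_queries (inc b) T \<le> q"
  shows "(\<Sum>w\<in>P. \<phi> (\<Phi> w) * \<psi> (result (inc (\<Phi> w)) T)) * real (card Q) =
         (\<Sum>b\<in>Q. \<phi> b * \<psi> (result (inc b) T)) * real (card P)"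
  using S \<phi> few
proof (induction T arbitrary: S \<phi>)
  case (Output y)
  show ?case
  \<comment> \<open>If no input in \<open>Q\<close> reaches the leaf, \<open>few\<close> says
    nothing about \<open>card S\<close>; then both sums vanish, the left one because
    \<open>\<Phi>\<close> maps into \<open>Q\<close>.\<close>
  proof (cases "\<forall>b\<in>Q. \<phi> b = 0")
    case True
    then show ?thesis using \<Phi> by simp
  next
    case False
    then have "card S \<le> q" using Output.prems(3) by fastforce
    have "(\<Sum>w\<in>P. \<phi> (\<Phi> w)) * real (card Q) = (\<Sum>b\<in>Q. \<phi> b) * real (card P)"
      by (rule local[OF Output.prems(1) \<open>card S \<le> q\<close>]) (rule Output.prems(2))
    then show ?thesis by (simp flip: sum_distrib_right)
  qed
next
  case (Query u i kont)
  define ans where "ans b = edge_at (inc b) u i" for b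
  \<comment> \<open>Fixing the answer \<open>\<alpha>\<close> in the weight leaves a single subtree
    \<open>kont \<alpha>\<close>, to which the induction hypothesis applies.\<close>
  define \<phi>' where "\<phi>' \<alpha> b = \<phi> b * of_bool (ans b = \<alpha>)" for \<alpha> b
  have dep: "\<phi>' \<alpha> b = \<phi>' \<alpha> b'" if "\<And>j. j \<in> S \<union> N u \<Longrightarrow> b j = b' j" for \<alpha> b b'
  proof -
    have "\<phi> b = \<phi> b'" by (rule Query.prems(2)) (use that in auto)
    moreover have "inc b u = inc b' u" by (rule inc) (use that in auto)
    ultimately show ?thesis unfolding \<phi>'_def ans_def edge_at_def by simp
  qed
  have split: "\<phi> b * \<psi> (result (inc b) (Query u i kont)) =
      (\<Sum>\<alpha>\<in>ans ` Q. \<phi>' \<alpha> b * \<psi> (result (inc b) (kont \<alpha>)))" if "b \<in> Q" for b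
  proof -
    have "(\<Sum>\<alpha>\<in>ans ` Q. \<phi>' \<alpha> b * \<psi> (result (inc b) (kont \<alpha>))) =
        (\<Sum>\<alpha>\<in>ans ` Q. if ans b = \<alpha> then \<phi> b * \<psi> (result (inc b) (kont \<alpha>)) else 0)"
      by (rule sum.cong) (auto simp: \<phi>'_def)
    also have "\<dots> = \<phi> b * \<psi> (result (inc b) (kont (ans b)))"
      using that Q by simp
    finally show ?thesis by (simp add: ans_def)
  qed
  have step: "(\<Sum>w\<in>P. \<phi>' \<alpha> (\<Phi> w) * \<psi> (result (inc (\<Phi> w)) (kont \<alpha>))) * real (card Q) =
      (\<Sum>b\<in>Q. \<phi>' \<alpha> b * \<psi> (result (inc b) (kont \<alpha>))) * real (card P)" for \<alpha>
  proof (rule Query.IH[of "kont \<alpha>" "S \<union> N u" "\<phi>' \<alpha>"])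
    show "finite (S \<union> N u)" using Query.prems(1) N by simp
    show "\<phi>' \<alpha> b = \<phi>' \<alpha> b'" if "\<And>j. j \<in> S \<union> N u \<Longrightarrow> b j = b' j" for b b'
      using dep that by blast
    show "card (S \<union> N u) + t * num_queries (inc b) (kont \<alpha>) \<le> q" if "b \<in> Q" "\<phi>' \<alpha> b \<noteq> 0" for b
    proof -
      have "ans b = \<alpha>" "\<phi> b \<noteq> 0" using that by (auto simp: \<phi>'_def)
      then have "card S + t * Suc (num_queries (inc b) (kont \<alpha>)) \<le> q"
        using Query.prems(3)[OF that(1)] by (simp add: ans_def)
      moreover have "card (S \<union> N u) \<le> card S + t"
        using card_Un_le[of S "N u"] N(2)[of u] by linarith
      ultimately show ?thesis by simp
    qed
  qed simp
  have "(\<Sum>w\<in>P. \<phi> (\<Phi> w) * \<psi> (result (inc (\<Phi> w)) (Query u i kont))) * real (card Q) =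
      (\<Sum>w\<in>P. \<Sum>\<alpha>\<in>ans ` Q. \<phi>' \<alpha> (\<Phi> w) * \<psi> (result (inc (\<Phi> w)) (kont \<alpha>))) * real (card Q)"
    using split \<Phi> by (simp cong: sum.cong)
  also have "\<dots> = (\<Sum>\<alpha>\<in>ans ` Q. (\<Sum>w\<in>P. \<phi>' \<alpha> (\<Phi> w) * \<psi> (result (inc (\<Phi> w)) (kont \<alpha>))) * real (card Q))"
    by (subst sum.swap) (simp add: sum_distrib_right)
  also have "\<dots> = (\<Sum>\<alpha>\<in>ans ` Q. (\<Sum>b\<in>Q. \<phi>' \<alpha> b * \<psi> (result (inc b) (kont \<alpha>))) * real (card P))"
    by (simp only: step)
  also have "\<dots> = (\<Sum>b\<in>Q. \<Sum>\<alpha>\<in>ans ` Q. \<phi>' \<alpha> b * \<psi> (result (inc b) (kont \<alpha>))) * real (card P)"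
    by (subst sum.swap) (simp add: sum_distrib_right)
  also have "\<dots> = (\<Sum>b\<in>Q. \<phi> b * \<psi> (result (inc b) (Query u i kont))) * real (card P)"
    using split by (simp cong: sum.cong)
  finally show ?case .
qed

subsection \<open>Expanding hypergraphs\<close>

text \<open>The quotient \<open>s ^ s / fact s\<close> is one term of the exponential series at
  \<open>s\<close>, and \<open>exp 1 \<le> 3\<close>.\<close>

lemma self_power_le_fact: "s ^ s \<le> 3 ^ s * (fact s :: nat)"
proof -
  have "real s ^ s / fact s \<le> (\<Sum>n. real s ^ n / fact n)"
    using sum_le_suminf[OF summable_exp_generic[of "real s"], of "{s}"]
    by (simp add: divide_inverse mult.commute)
  also have "\<dots> = exp (real s)"
    by (simp add: exp_def divide_inverse mult.commute)
  also have "\<dots> = exp 1 ^ s" by (simp flip: exp_of_nat_mult)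
  also have "\<dots> \<le> 3 ^ s" by (intro power_mono exp_le) simp
  finally have "real s ^ s \<le> 3 ^ s * fact s" by (simp add: field_simps)
  then have "real (s ^ s) \<le> real (3 ^ s * fact s)" by simp
  then show ?thesis by (simp only: of_nat_le_iff)
qed

lemma binomial_mult_self_power_le: "(n choose s) * s ^ s \<le> (3 * n) ^ s"
proof -
  have "(n choose s) * s ^ s \<le> (n choose s) * (3 ^ s * fact s)"
    by (intro mult_left_mono self_power_le_fact) simp
  also have "\<dots> = 3 ^ s * ((n choose s) * fact s)" by simp
  also have "\<dots> \<le> 3 ^ s * n ^ s" by (intro mult_left_mono binomial_fact_pow) simp
  finally show ?thesis by (simp add: power_mult_distrib)
qed

text \<open>One size \<open>s\<close> in the union bound of \<open>expander_exists\<close>: over all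
  choices of \<open>s\<close> constraints and \<open>r = (k - 2) * s\<close> variables, the
  probabilities \<open>(r / V) ^ (k * s)\<close> that these constraints see only these variables add
  up to at most \<open>(1 / 4) ^ s\<close>.\<close>

lemma expansion_union_bound_term:
  fixes k s M V r :: nat
  assumes "12 * M * 3 ^ k * k\<^sup>2 * s \<le> V" and r: "r + 2 * s = k * s"
  shows "(M * V choose s) * (V choose r) * r ^ (k * s) * 4 ^ s \<le> V ^ (k * s)"
proof -
  have rk: "r \<le> k * s" using r by simp
  have twelve: "(12 :: nat) ^ s = 3 ^ s * 4 ^ s" by (simp flip: power_mult_distrib)
  \<comment> \<open>Of the \<open>k * s\<close> factors \<open>r\<close>, a number \<open>r\<close>
    of them is absorbed by \<open>V choose r\<close>; the other \<open>2 * s\<close> are at most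
    \<open>k * s\<close> each. Half of the resulting \<open>s ^ (2 * s)\<close> is absorbed by
    \<open>M * V choose s\<close>, the other half is paid for by the lower bound on
    \<open>V\<close>.\<close>
  have "(M * V choose s) * (V choose r) * r ^ (k * s) * 4 ^ s =
      (M * V choose s) * ((V choose r) * r ^ r) * (r ^ 2) ^ s * 4 ^ s"
    by (simp flip: r add: power_add power_mult)
  also have "\<dots> \<le> (M * V choose s) * (3 * V) ^ r * ((k * s)\<^sup>2) ^ s * 4 ^ s"
    by (intro mult_mono binomial_mult_self_power_le power_mono rk) simp_all
  also have "\<dots> = ((M * V choose s) * s ^ s) * (3 * V) ^ r * (s * k\<^sup>2 * 4) ^ s"
    by (simp add: power_mult_distrib power2_eq_square)
  also have "\<dots> \<le> (3 * (M * V)) ^ s * (3 * V) ^ r * (s * k\<^sup>2 * 4) ^ s"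
    by (intro mult_mono binomial_mult_self_power_le) simp_all
  also have "\<dots> = 3 ^ r * (12 * M * k\<^sup>2 * s) ^ s * V ^ (r + s)"
    by (simp add: power_mult_distrib power_add mult_ac twelve)
  also have "\<dots> \<le> 3 ^ (k * s) * (12 * M * k\<^sup>2 * s) ^ s * V ^ (r + s)"
    by (intro mult_right_mono power_increasing rk) simp_all
  also have "\<dots> = (12 * M * 3 ^ k * k\<^sup>2 * s) ^ s * V ^ (r + s)"
    by (simp add: power_mult_distrib power_mult mult_ac)
  also have "\<dots> \<le> V ^ s * V ^ (r + s)"
    by (intro mult_right_mono power_mono assms) simp_all
  also have "\<dots> = V ^ (k * s)" by (simp flip: r power_add add: ac_simps mult_2 mult_2_right)
  finally show ?thesis .
qed

lemma sum_quarter_powers: "(\<Sum>s = 1..n. (1 / 4 :: real) ^ s) < 1"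
proof -
  have "(\<Sum>s = 1..n. (1 / 4 :: real) ^ s) = (1 - (1 / 4) ^ n) / 3"
    by (induction n) (simp_all add: diff_divide_distrib)
  also have "\<dots> < 1" by (simp add: field_simps add_pos_pos)
  finally show ?thesis .
qed

text \<open>Union bound for a uniformly random \<open>x\<close>, done by counting the functions in
  \<open>F\<close>. If \<open>S\<close> fails to expand, all its variables lie in some
  \<open>R\<close> of exactly \<open>r (card S)\<close> variables; \<open>bad S R\<close> collects
  the \<open>x\<close> for which this happens, and these sets are together too small to cover
  \<open>F\<close>.\<close>

lemma expander_exists:
  fixes k M V s0 :: nat
  assumes k: "2 \<le> k" and V: "0 < V" and s0: "12 * M * 3 ^ k * k\<^sup>2 * s0 \<le> V" and M: "0 < M"
  shows "\<exists>x :: nat \<times> nat \<Rightarrow> nat. x ` ({..<M * V} \<times> {..<k}) \<subseteq> {..<V} \<and>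
    (\<forall>S\<subseteq>{..<M * V}. S \<noteq> {} \<longrightarrow> card S \<le> s0 \<longrightarrow>
       k * card S < card (x ` (S \<times> {..<k})) + 2 * card S)"
proof -
  define m where "m = M * V"
  define F where "F = ({..<m} \<times> {..<k}) \<rightarrow>\<^sub>E {..<V}"
  define r where "r s = (k - 2) * s" for s
  define Sub where "Sub s = {S. S \<subseteq> {..<m} \<and> card S = s} \<times> {R. R \<subseteq> {..<V} \<and> card R = r s}" for s
  define I where "I = (SIGMA s:{1..s0}. Sub s)"
  define bad where "bad S R = {x \<in> F. x ` (S \<times> {..<k}) \<subseteq> R}" for S R
  have r: "r s + 2 * s = k * s" for s
    using k by (simp add: r_def diff_mult_distrib)
  have card_F: "card F = V ^ (k * m)"
    unfolding F_def by (subst card_PiE) (simp_all add: mult.commute)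
  have fin_Sub: "finite (Sub s)" for s by (simp add: Sub_def)
  have card_Sub: "card (Sub s) = (m choose s) * (V choose r s)" for s
    unfolding Sub_def by (simp add: card_cartesian_product n_subsets)
  have fin_I: "finite I" unfolding I_def using fin_Sub by auto
  have card_bad: "real (card (bad S R)) = real (r s) ^ (k * s) * real V ^ (k * m) / real V ^ (k * s)"
    if "(S, R) \<in> Sub s" for S R s
  proof -
    have S: "S \<subseteq> {..<m}" "card S = s" and R: "R \<subseteq> {..<V}" "card R = r s"
      using that by (auto simp: Sub_def)
    have fS: "finite S" using S finite_subset by blast
    have "bad S R = PiE ({..<m} \<times> {..<k}) (\<lambda>\<rho>. if fst \<rho> \<in> S then R else {..<V})" (is "_ = ?P")
    proof (rule set_eqI)
      fix x
      show "x \<in> bad S R \<longleftrightarrow> x \<in> ?P"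
      proof
        assume "x \<in> bad S R"
        then show "x \<in> ?P" unfolding bad_def F_def PiE_iff by auto
      next
        assume x: "x \<in> ?P"
        have "x \<rho> \<in> {..<V}" if "\<rho> \<in> {..<m} \<times> {..<k}" for \<rho>
          using PiE_mem[OF x that] R(1) by (auto split: if_splits)
        moreover have "x \<rho> \<in> R" if "\<rho> \<in> S \<times> {..<k}" for \<rho>
          using PiE_mem[OF x, of \<rho>] that S by (auto split: if_splits)
        ultimately show "x \<in> bad S R"
          using x unfolding bad_def F_def PiE_iff by auto
      qed
    qed
    then have "card (bad S R) = (\<Prod>\<rho>\<in>{..<m} \<times> {..<k}. if fst \<rho> \<in> S then r s else V)"
      by (simp add: card_PiE if_distrib R cong: if_cong)
    also have "\<dots> = (\<Prod>\<rho>\<in>S \<times> {..<k}. r s) * (\<Prod>\<rho>\<in>({..<m} - S) \<times> {..<k}. V)"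
    proof -
      let ?g = "\<lambda>\<rho>::nat \<times> nat. if fst \<rho> \<in> S then r s else V"
      have "{..<m} \<times> {..<k} = S \<times> {..<k} \<union> ({..<m} - S) \<times> {..<k}" using S by auto
      then have "prod ?g ({..<m} \<times> {..<k}) = prod ?g (S \<times> {..<k}) * prod ?g (({..<m} - S) \<times> {..<k})"
        using fS by (metis (no_types, lifting) Diff_disjoint Sigma_Int_distrib1 Sigma_empty1
            finite_Diff finite_SigmaI finite_lessThan prod.union_disjoint)
      moreover have "prod ?g (S \<times> {..<k}) = (\<Prod>\<rho>\<in>S \<times> {..<k}. r s)"
        by (rule prod.cong) auto
      moreover have "prod ?g (({..<m} - S) \<times> {..<k}) = (\<Prod>\<rho>\<in>({..<m} - S) \<times> {..<k}. V)"
        by (rule prod.cong) auto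
      ultimately show ?thesis by (simp only:)
    qed
    also have "\<dots> = r s ^ (k * s) * V ^ (k * (m - s))"
      using S fS by (simp add: card_cartesian_product card_Diff_subset mult.commute)
    finally have "card (bad S R) = r s ^ (k * s) * V ^ (k * (m - s))" .
    moreover have "s \<le> m" using S by (metis card_lessThan card_mono finite_lessThan)
    then have "V ^ (k * m) = V ^ (k * (m - s)) * V ^ (k * s)"
      by (simp flip: power_add distrib_left)
    then have "real V ^ (k * m) = real V ^ (k * (m - s)) * real V ^ (k * s)"
      by (metis of_nat_mult of_nat_power)
    ultimately show ?thesis using V by simp
  qed
  have "real (card (\<Union>(s, S, R)\<in>I. bad S R)) \<le> real (\<Sum>(s, S, R)\<in>I. card (bad S R))"
    unfolding of_nat_le_iff
    using card_UN_le[OF fin_I, of "\<lambda>(s, S, R). bad S R"] by (simp add: case_prod_unfold)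
  also have "\<dots> = (\<Sum>s = 1..s0. \<Sum>(S, R)\<in>Sub s. real (card (bad S R)))"
    unfolding I_def by (subst sum.Sigma) (use fin_Sub in \<open>auto simp: case_prod_unfold\<close>)
  also have "\<dots> = (\<Sum>s = 1..s0. \<Sum>(S, R)\<in>Sub s. real (r s) ^ (k * s) * real V ^ (k * m) / real V ^ (k * s))"
    by (intro sum.cong refl) (auto simp: card_bad)
  also have "\<dots> = (\<Sum>s = 1..s0. real (card (Sub s)) * (real (r s) ^ (k * s) * real V ^ (k * m) / real V ^ (k * s)))"
    by simp
  also have "\<dots> \<le> (\<Sum>s = 1..s0. (1 / 4) ^ s * real V ^ (k * m))"
  proof (rule sum_mono)
    fix s assume "s \<in> {1..s0}"
    then have "12 * M * 3 ^ k * k\<^sup>2 * s \<le> 12 * M * 3 ^ k * k\<^sup>2 * s0" by simp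
    also note s0
    finally have "(m choose s) * (V choose r s) * r s ^ (k * s) * 4 ^ s \<le> V ^ (k * s)"
      unfolding m_def by (intro expansion_union_bound_term r)
    then have "real ((m choose s) * (V choose r s) * r s ^ (k * s) * 4 ^ s) \<le> real (V ^ (k * s))"
      by (simp only: of_nat_le_iff)
    then have "real ((m choose s) * (V choose r s)) * real (r s) ^ (k * s) / real V ^ (k * s) \<le> (1 / 4) ^ s"
      using V by (simp add: field_simps)
    from mult_right_mono[OF this, of "real V ^ (k * m)"]
    show "real (card (Sub s)) * (real (r s) ^ (k * s) * real V ^ (k * m) / real V ^ (k * s))
        \<le> (1 / 4) ^ s * real V ^ (k * m)"
      by (simp add: card_Sub mult_ac)
  qed
  also have "\<dots> = (\<Sum>s = 1..s0. (1 / 4) ^ s) * real V ^ (k * m)" by (rule sum_distrib_right[symmetric])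
  also have "\<dots> < 1 * real V ^ (k * m)"
    using V by (intro mult_strict_right_mono sum_quarter_powers) simp
  also have "\<dots> = real (card F)" by (simp add: card_F)
  finally have "\<not> F \<subseteq> (\<Union>(s, S, R)\<in>I. bad S R)"
  proof -
    assume lt: "real (card (\<Union>(s, S, R)\<in>I. bad S R)) < real (card F)"
    have "finite F" unfolding F_def by (intro finite_PiE) auto
    then have "finite (\<Union>(s, S, R)\<in>I. bad S R)" using fin_I by (auto simp: bad_def)
    then show ?thesis using lt by (metis card_mono leD of_nat_le_iff)
  qed
  then obtain x where x: "x \<in> F" "x \<notin> (\<Union>(s, S, R)\<in>I. bad S R)" by blast
  have im: "x ` ({..<m} \<times> {..<k}) \<subseteq> {..<V}" using x(1) by (auto simp: F_def)
  have "k * card S < card (x ` (S \<times> {..<k})) + 2 * card S"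
    if S: "S \<subseteq> {..<m}" "S \<noteq> {}" "card S \<le> s0" for S
  proof (rule ccontr)
    assume "\<not> ?thesis"
    then have "card (x ` (S \<times> {..<k})) \<le> r (card S)" using r[of "card S"] by linarith
    \<comment> \<open>Padding the variables of \<open>S\<close> to a set \<open>R\<close> of exactly
      this size requires that many variables to exist.\<close>
    moreover have "r (card S) \<le> V"
    proof -
      have "r (card S) \<le> k * s0" using r[of "card S"] mult_le_mono2[OF S(3), of k] by linarith
      also have "\<dots> \<le> 12 * M * 3 ^ k * k\<^sup>2 * s0" using M k by (simp add: power2_eq_square)
      finally show ?thesis using s0 by simp
    qed
    moreover have "x ` (S \<times> {..<k}) \<subseteq> {..<V}" using im S by blast
    ultimately obtain R where R: "x ` (S \<times> {..<k}) \<subseteq> R" "R \<subseteq> {..<V}" "card R = r (card S)"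
      using exists_subset_between[of "x ` (S \<times> {..<k})" "r (card S)" "{..<V}"] by auto
    have "card S \<ge> 1" using S by (metis One_nat_def Suc_leI card_gt_0_iff finite_lessThan finite_subset)
    then have "(card S, S, R) \<in> I" using S R by (auto simp: I_def Sub_def)
    moreover have "x \<in> bad S R" using x(1) R by (simp add: bad_def)
    ultimately show False using x(2) by auto
  qed
  then show ?thesis using im unfolding m_def by blast
qed

text \<open>
  Splitting the variables of high degree bounds the degree without hurting the expansion.
\<close>

lemma bounded_fiber_refinement:
  fixes x :: "'a \<Rightarrow> 'b"
  assumes A: "finite A" and D: "0 < D"
  shows "\<exists>y :: 'a \<Rightarrow> 'b \<times> nat. (\<forall>a\<in>A. fst (y a) = x a) \<and>
    card (y ` A) \<le> card (x ` A) + card A div D \<and> (\<forall>z. card {a \<in> A. y a = z} \<le> D)"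
proof -
  define F where "F b = {a \<in> A. x a = b}" for b
  have fF: "finite (F b)" for b using A by (simp add: F_def)
  have "\<exists>h. bij_betw h (F b) {0..<card (F b)}" for b
    by (rule ex_bij_betw_finite_nat[OF fF])
  then obtain h where h: "\<And>b. bij_betw (h b) (F b) {0..<card (F b)}" by metis
  \<comment> \<open>Each fiber is numbered and cut into blocks of length \<open>D\<close>. A fiber
    of size \<open>c\<close> uses at most \<open>c div D + 1\<close> labels, and the terms
    \<open>c div D\<close> sum to at most \<open>card A div D\<close>.\<close>
  define y where "y a = (x a, h (x a) a div D)" for a
  have "y ` A \<subseteq> (SIGMA b:x ` A. {..card (F b) div D})"
  proof
    fix z assume "z \<in> y ` A"
    then obtain a where a: "a \<in> A" "z = y a" by blast
    then have "h (x a) a \<in> {0..<card (F (x a))}"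
      using bij_betwE[OF h[of "x a"]] by (simp add: F_def)
    then show "z \<in> (SIGMA b:x ` A. {..card (F b) div D})"
      using a by (auto simp: y_def intro: div_le_mono)
  qed
  then have "card (y ` A) \<le> card (SIGMA b:x ` A. {..card (F b) div D})"
    using A by (intro card_mono) auto
  also have "\<dots> = card (x ` A) + (\<Sum>b\<in>x ` A. card (F b) div D)"
    using A by (simp add: sum_Suc)
  also have "(\<Sum>b\<in>x ` A. card (F b) div D) \<le> card A div D"
  proof -
    have "D * (\<Sum>b\<in>x ` A. card (F b) div D) \<le> (\<Sum>b\<in>x ` A. card (F b))"
      unfolding sum_distrib_left by (rule sum_mono) simp
    also have "\<dots> = card A"
      unfolding F_def card_eq_sum by (rule sum.image_gen[OF A, symmetric])
    finally show ?thesis using D by (simp add: less_eq_div_iff_mult_less_eq mult.commute)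
  qed
  finally have "card (y ` A) \<le> card (x ` A) + card A div D" by simp
  moreover have "card {a \<in> A. y a = z} \<le> D" for z
  proof (cases z)
    case (Pair b q)
    have "card {a \<in> A. y a = z} \<le> card {q * D..<q * D + D}"
    proof (rule card_inj_on_le)
      have "{a \<in> A. y a = z} \<subseteq> F b" by (auto simp: Pair y_def F_def)
      then show "inj_on (h b) {a \<in> A. y a = z}"
        using h bij_betw_imp_inj_on inj_on_subset by blast
      show "h b ` {a \<in> A. y a = z} \<subseteq> {q * D..<q * D + D}"
        using dividend_less_div_times[OF D] by (auto simp: Pair y_def add.commute[of "_ * _"])
    qed simp
    then show ?thesis by simp
  qed
  moreover have "\<forall>a\<in>A. fst (y a) = x a" by (simp add: y_def)
  ultimately show ?thesis by blast
qed

subsection \<open>The graph of a parity constraint system\<close>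

lemma max_independent_set_le:
  assumes "\<And>S. independent_set n E S \<Longrightarrow> card S \<le> t"
  shows "max_independent_set n E \<le> t"
proof -
  have "finite {S. independent_set n E S}"
    by (rule finite_subset[of _ "Pow {..<n}"]) (auto simp: independent_set_def)
  moreover have "independent_set n E {}" by (simp add: independent_set_def)
  ultimately show ?thesis
    unfolding max_independent_set_def using assms by (subst Max_le_iff) auto
qed

lemma card_le_max_independent_set:
  assumes "independent_set n E S"
  shows "card S \<le> max_independent_set n E"
proof -
  have "finite {S. independent_set n E S}"
    by (rule finite_subset[of _ "Pow {..<n}"]) (auto simp: independent_set_def)
  then show ?thesis
    unfolding max_independent_set_def using assms by (intro Max_ge) auto
qed

text \<open>
  \<open>x (j, i)\<close> is the variable in position \<open>i\<close> of constraint \<open>j\<close>.  Pattern \<open>a < 2\<^sup>r\<close> of a constraint has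
  the bit \<open>|e a \<inter> v i| mod 2\<close> in position \<open>i\<close>, up to the shift \<open>b j\<close> of the constraint.  That all
  \<open>v i\<close> contain 0 and are distinct makes the dual distance at least 4.
\<close>

locale parity_csp =
  fixes k r m V s0 D :: nat and x :: "nat \<times> nat \<Rightarrow> 'v" and v e :: "nat \<Rightarrow> nat set"
  assumes k: "0 < k"
    and v: "\<And>i. i < k \<Longrightarrow> v i \<subseteq> {..<r}" "\<And>i. i < k \<Longrightarrow> 0 \<in> v i" "inj_on v {..<k}"
    and e: "bij_betw e {..<2 ^ r} (Pow {..<r})"
    and expansion: "\<And>S. S \<subseteq> {..<m} \<Longrightarrow> S \<noteq> {} \<Longrightarrow> card S \<le> s0 \<Longrightarrow>
      k * card S < card (x ` (S \<times> {..<k})) + 2 * card S"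
    and few_vars: "card (x ` ({..<m} \<times> {..<k})) \<le> 2 * V"
    and fibers: "\<And>y. card {\<rho> \<in> {..<m} \<times> {..<k}. x \<rho> = y} \<le> D"
    and x_inj: "\<And>j i i'. j < m \<Longrightarrow> i < k \<Longrightarrow> i' < k \<Longrightarrow> x (j, i) = x (j, i') \<Longrightarrow> i = i'"
    and m_eq: "m * 2 ^ r = V * 2 ^ k"
begin

abbreviation L :: nat where "L \<equiv> 2 ^ r"

definition vars :: "'v set" where "vars = x ` ({..<m} \<times> {..<k})"

text \<open>Vertex \<open>u\<close> encodes constraint \<open>u div L\<close> with pattern
  \<open>u mod L\<close>; \<open>\<noteq>\<close> on truth values is addition in Z_2.\<close>

definition val :: "(nat \<Rightarrow> nat set) \<Rightarrow> nat \<Rightarrow> nat \<Rightarrow> bool" where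
  "val b u i \<longleftrightarrow> (i \<in> b (u div L)) \<noteq> odd (card (e (u mod L) \<inter> v i))"

text \<open>Any two patterns of one constraint conflict, so an independent set uses each constraint
  at most once.\<close>

definition conflict :: "(nat \<Rightarrow> nat set) \<Rightarrow> nat \<Rightarrow> nat \<Rightarrow> bool" where
  "conflict b u u' \<longleftrightarrow> u \<noteq> u' \<and> (u div L = u' div L \<or>
     (\<exists>i<k. \<exists>i'<k. x (u div L, i) = x (u' div L, i') \<and> val b u i \<noteq> val b u' i'))"

definition edges :: "(nat \<Rightarrow> nat set) \<Rightarrow> nat set set" where
  "edges b = {{u, u'} | u u'. u < m * L \<and> u' < m * L \<and> conflict b u u'}"

text \<open>The fixed increasing order makes the list depend only on the conflicts at
  \<open>u\<close>, so the ordering leaks nothing about shifts elsewhere.\<close>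

definition inc :: "(nat \<Rightarrow> nat set) \<Rightarrow> nat \<Rightarrow> nat set list" where
  "inc b u = map (\<lambda>u'. {u, u'}) (filter (\<lambda>u'. u < m * L \<and> conflict b u u') [0..<m * L])"

text \<open>A query at \<open>u\<close> reveals at most the shifts of these constraints.\<close>

definition nbrs :: "nat \<Rightarrow> nat set" where
  "nbrs u = {j. j < m \<and> (\<exists>i<k. \<exists>i'<k. x (u div L, i) = x (j, i'))}"

text \<open>
  In the planted case, the seed consists of an assignment (\<open>Inl\<close>) and one pattern for each
  constraint (\<open>Inr\<close>); \<open>W (j, i)\<close> lists the seed bits whose sum is bit \<open>i\<close> of the shift of \<open>j\<close>.
\<close>

definition W :: "nat \<times> nat \<Rightarrow> ('v + nat \<times> nat) set" where
  "W \<rho> = insert (Inl (x \<rho>)) ((\<lambda>l. Inr (fst \<rho>, l)) ` v (snd \<rho>))"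

definition U :: "('v + nat \<times> nat) set" where
  "U = Inl ` vars \<union> Inr ` ({..<m} \<times> {..<r})"

definition planted :: "('v + nat \<times> nat) set \<Rightarrow> nat \<Rightarrow> nat set" where
  "planted w = (\<lambda>j\<in>{..<m}. {i. i < k \<and> odd (card (w \<inter> W (j, i)))})"

definition Q :: "(nat \<Rightarrow> nat set) set" where
  "Q = {..<m} \<rightarrow>\<^sub>E Pow {..<k}"

definition sat :: "'v set \<Rightarrow> nat \<Rightarrow> nat set \<Rightarrow> bool" where
  "sat X j B \<longleftrightarrow> (\<exists>a<L. \<forall>i<k. ((i \<in> B) \<noteq> odd (card (e a \<inter> v i))) \<longleftrightarrow> x (j, i) \<in> X)"

section \<open>The graph as a bounded-degree instance with local incidence lists\<close>

lemma div_less: "u < m * L \<Longrightarrow> u div L < m"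
  by (simp add: less_mult_imp_div_less)

lemma conflict_sym: "conflict b u u' \<longleftrightarrow> conflict b u' u"
  unfolding conflict_def by metis

lemma edges_iff: "{u, u'} \<in> edges b \<longleftrightarrow> u < m * L \<and> u' < m * L \<and> conflict b u u'"
  unfolding edges_def using conflict_sym by (auto simp: doubleton_eq_iff)

lemma simple: "m * L \<le> n \<Longrightarrow> simple_graph n (edges b)"
  unfolding simple_graph_def edges_def by (auto simp: conflict_def card_2_iff)

lemma edges_at: "{ed \<in> edges b. u \<in> ed} = (\<lambda>u'. {u, u'}) ` {u'. u < m * L \<and> u' < m * L \<and> conflict b u u'}"
proof -
  have "ed \<in> (\<lambda>u'. {u, u'}) ` {u'. u < m * L \<and> u' < m * L \<and> conflict b u u'}"
    if "ed \<in> edges b" "u \<in> ed" for ed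
  proof -
    obtain p q where pq: "ed = {p, q}" "p < m * L" "q < m * L" "conflict b p q"
      using \<open>ed \<in> edges b\<close> by (auto simp: edges_def)
    then consider "u = p" | "u = q" using \<open>u \<in> ed\<close> by blast
    then show ?thesis
      using pq conflict_sym[of b p q] by cases (auto simp: insert_commute)
  qed
  then show ?thesis by (auto simp: edges_iff)
qed

lemma incidence: "incidence_lists (edges b) (inc b)"
proof -
  have "inj_on (\<lambda>u'. {u, u'}) A" for u :: nat and A
    by (auto simp: inj_on_def doubleton_eq_iff)
  then show ?thesis
    unfolding incidence_lists_def inc_def edges_at
    by (auto simp: distinct_map)
qed

lemma finite_nbrs: "finite (nbrs u)"
  by (simp add: nbrs_def)

lemma card_nbrs: "card (nbrs u) \<le> k * D"
proof -
  let ?F = "\<lambda>i. {\<rho> \<in> {..<m} \<times> {..<k}. x \<rho> = x (u div L, i)}"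
  have "nbrs u \<subseteq> (\<Union>i<k. fst ` ?F i)"
    unfolding nbrs_def by force
  moreover have fin: "finite (?F i)" for i by simp
  ultimately have "card (nbrs u) \<le> card (\<Union>i<k. fst ` ?F i)"
    by (intro card_mono) auto
  also have "\<dots> \<le> (\<Sum>i<k. card (fst ` ?F i))" by (rule card_UN_le) simp
  also have "\<dots> \<le> (\<Sum>i<k. D)"
    by (rule sum_mono) (use card_image_le[OF fin] fibers in \<open>blast intro: le_trans\<close>)
  finally show ?thesis by simp
qed

lemma conflict_nbrs:
  assumes "u < m * L" "u' < m * L" "conflict b u u'"
  shows "u div L \<in> nbrs u" "u' div L \<in> nbrs u"
proof -
  have "\<exists>i<k. \<exists>i'<k. x (u div L, i) = x (u' div L, i')"
  proof (cases "u div L = u' div L")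
    case True
    then show ?thesis using k by (intro exI[of _ 0]) auto
  next
    case False
    then show ?thesis using assms(3) unfolding conflict_def by blast
  qed
  then show "u div L \<in> nbrs u" "u' div L \<in> nbrs u"
    using div_less assms(1,2) unfolding nbrs_def by auto
qed

lemma degree: "degree_bound n (edges b) (k * D * L)"
  unfolding degree_bound_def
proof (intro allI impI)
  fix u
  have "{u'. u < m * L \<and> u' < m * L \<and> conflict b u u'} \<subseteq> (\<lambda>(j, a). j * L + a) ` (nbrs u \<times> {..<L})"
  proof
    fix u' assume "u' \<in> {u'. u < m * L \<and> u' < m * L \<and> conflict b u u'}"
    then have "(u' div L, u' mod L) \<in> nbrs u \<times> {..<L}" using conflict_nbrs by auto
    then show "u' \<in> (\<lambda>(j, a). j * L + a) ` (nbrs u \<times> {..<L})"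
      by (rule rev_image_eqI) (simp only: prod.case div_mult_mod_eq)
  qed
  then have "card {ed \<in> edges b. u \<in> ed} \<le> card (nbrs u \<times> {..<L})"
    unfolding edges_at image_image using finite_nbrs
    by (meson card_image_le card_mono finite_SigmaI finite_imageI finite_lessThan finite_subset le_trans)
  also have "\<dots> \<le> k * D * L" using card_nbrs by (simp add: card_cartesian_product)
  finally show "card {ed \<in> edges b. u \<in> ed} \<le> k * D * L" .
qed

lemma inc_cong:
  assumes "\<And>j. j \<in> nbrs u \<Longrightarrow> b j = b' j"
  shows "inc b u = inc b' u"
proof -
  have "conflict b u u' \<longleftrightarrow> conflict b' u u'" if "u < m * L" "u' < m * L" for u'
  proof -
    have "val b u i = val b' u i \<and> val b u' i' = val b' u' i'"
      if "i < k" "i' < k" "x (u div L, i) = x (u' div L, i')" for i i'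
    proof -
      have "u div L \<in> nbrs u" "u' div L \<in> nbrs u"
        using that \<open>u < m * L\<close> \<open>u' < m * L\<close> div_less unfolding nbrs_def by blast+
      then show ?thesis using assms by (simp add: val_def)
    qed
    then show ?thesis unfolding conflict_def by metis
  qed
  then show ?thesis unfolding inc_def by (auto intro!: map_cong filter_cong)
qed

section \<open>Linear independence on small sets of constraints, and uniform marginals\<close>

lemma Inl_in_W: "Inl y \<in> W \<rho> \<longleftrightarrow> x \<rho> = y"
  by (auto simp: W_def)

lemma Inr_in_W: "Inr (j, l) \<in> W \<rho> \<longleftrightarrow> fst \<rho> = j \<and> l \<in> v (snd \<rho>)"
  by (auto simp: W_def)

lemma finite_U: "finite U"
  by (simp add: U_def vars_def)

text \<open>Dual distance at least 4: every \<open>v i\<close> contains 0, so coordinate 0 forces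
  \<open>card Y\<close> to be even, and size 2 would make two of the distinct sets
  \<open>v i\<close> equal.\<close>

lemma four_le_card_even_cover:
  assumes Y: "Y \<subseteq> {..<k}" "Y \<noteq> {}" and even: "\<And>l. l < r \<Longrightarrow> even (card {i \<in> Y. l \<in> v i})"
  shows "4 \<le> card Y"
proof -
  have fY: "finite Y" using Y finite_subset by blast
  obtain i0 where i0: "i0 \<in> Y" using Y by blast
  then have "0 < r" using v(1,2)[of i0] Y by auto
  moreover have "{i \<in> Y. 0 \<in> v i} = Y" using v(2) Y by auto
  ultimately have "even (card Y)" using even[of 0] by simp
  moreover have "card Y \<noteq> 0" using fY i0 by auto
  moreover have "card Y \<noteq> 2"
  proof
    assume "card Y = 2"
    then obtain i i' where ii: "Y = {i, i'}" "i \<noteq> i'" by (auto simp: card_2_iff)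
    then have "v i \<noteq> v i'" using v(3) Y by (auto simp: inj_on_def)
    then obtain l where l: "l \<in> v i \<longleftrightarrow> l \<notin> v i'" by blast
    then have "l < r" using v(1) Y ii by (metis insert_subset lessThan_iff subsetD)
    moreover have "{h \<in> Y. l \<in> v h} = (if l \<in> v i then {i} else {i'})" using l ii by auto
    ultimately show False using even[of l] by (simp split: if_splits)
  qed
  ultimately show ?thesis by presburger
qed

text \<open>A nonempty dependency \<open>Y\<close> touching the constraints \<open>S'\<close> has at
  least 4 rows in each of them, by the columns \<open>Inr\<close>, and meets each of its variables
  at least twice, by the columns \<open>Inl\<close>. Hence \<open>S'\<close> sees at most
  \<open>card Y / 2 + (k * card S' - card Y)\<close> variables, so at most
  \<open>(k - 2) * card S'\<close>, against expansion.\<close>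

lemma rows_independent:
  assumes S: "S \<subseteq> {..<m}" "card S \<le> s0" and Y: "Y \<subseteq> S \<times> {..<k}" "Y \<noteq> {}"
  shows "\<exists>u\<in>U. odd (card {\<rho>\<in>Y. u \<in> W \<rho>})"
proof (rule ccontr)
  assume "\<not> ?thesis"
  then have even: "even (card {\<rho>\<in>Y. u \<in> W \<rho>})" if "u \<in> U" for u using that by blast
  have fS: "finite S" using S finite_subset by blast
  then have fY: "finite Y" using Y finite_subset by blast
  define S' where "S' = fst ` Y"
  define Yj where "Yj j = {i. (j, i) \<in> Y}" for j
  have S': "S' \<subseteq> S" "S' \<noteq> {}" using Y by (auto simp: S'_def)
  have fS': "finite S'" using S' fS finite_subset by blast
  have Yk: "Y \<subseteq> S' \<times> {..<k}" using Y by (auto simp: S'_def) force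
  have four: "4 \<le> card (Yj j)" if "j \<in> S'" for j
  proof (rule four_le_card_even_cover)
    show "Yj j \<subseteq> {..<k}" "Yj j \<noteq> {}" using that Yk by (auto simp: Yj_def S'_def)
    fix l assume "l < r"
    then have "Inr (j, l) \<in> U" using that S' S by (auto simp: U_def)
    from even[OF this] have "even (card {\<rho> \<in> Y. fst \<rho> = j \<and> l \<in> v (snd \<rho>)})" by (simp add: Inr_in_W)
    moreover have "{\<rho> \<in> Y. fst \<rho> = j \<and> l \<in> v (snd \<rho>)} = Pair j ` {i \<in> Yj j. l \<in> v i}"
      by (auto simp: Yj_def)
    ultimately show "even (card {i \<in> Yj j. l \<in> v i})"
      by (simp add: card_image inj_on_def)
  qed
  have "finite (Yj j)" for j
    using finite_imageI[OF fY, of snd] by (rule finite_subset[rotated]) (force simp: Yj_def)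
  moreover have "Y = Sigma S' Yj" by (auto simp: S'_def Yj_def) force
  ultimately have "card Y = (\<Sum>j\<in>S'. card (Yj j))" using fS' by simp
  also have "\<dots> \<ge> (\<Sum>j\<in>S'. 4)" by (intro sum_mono four)
  finally have card_Y: "4 * card S' \<le> card Y" by simp
  have "2 * card (x ` Y) = (\<Sum>y\<in>x ` Y. 2)" by simp
  also have "\<dots> \<le> (\<Sum>y\<in>x ` Y. card {\<rho> \<in> Y. x \<rho> = y})"
  proof (rule sum_mono)
    fix y assume y: "y \<in> x ` Y"
    have "Y \<subseteq> {..<m} \<times> {..<k}" using Y S by blast
    then have "Inl y \<in> U" using y unfolding U_def vars_def by blast
    from even[OF this] have "even (card {\<rho> \<in> Y. x \<rho> = y})" by (simp add: Inl_in_W)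
    moreover have "card {\<rho> \<in> Y. x \<rho> = y} \<noteq> 0" using y fY by auto
    ultimately show "2 \<le> card {\<rho> \<in> Y. x \<rho> = y}" by presburger
  qed
  also have "\<dots> = card Y" unfolding card_eq_sum by (rule sum.image_gen[OF fY, symmetric])
  finally have xY: "2 * card (x ` Y) \<le> card Y" .
  have "x ` (S' \<times> {..<k}) \<subseteq> x ` Y \<union> x ` (S' \<times> {..<k} - Y)" by blast
  then have "card (x ` (S' \<times> {..<k})) \<le> card (x ` Y \<union> x ` (S' \<times> {..<k} - Y))"
    using fY fS' by (intro card_mono) auto
  also have "\<dots> \<le> card (x ` Y) + card (x ` (S' \<times> {..<k} - Y))" by (rule card_Un_le)
  also have "card (x ` (S' \<times> {..<k} - Y)) \<le> card (S' \<times> {..<k} - Y)"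
    using fS' by (intro card_image_le) auto
  also have "card (S' \<times> {..<k} - Y) = card (S' \<times> {..<k}) - card Y"
    using fY Yk by (simp add: card_Diff_subset)
  finally have "card (x ` (S' \<times> {..<k})) \<le> card (x ` Y) + (card (S' \<times> {..<k}) - card Y)" by simp
  moreover have "card Y \<le> card (S' \<times> {..<k})" using Yk fS' by (intro card_mono) auto
  moreover have "card (S' \<times> {..<k}) = k * card S'" by (simp add: card_cartesian_product)
  moreover have "k * card S' < card (x ` (S' \<times> {..<k})) + 2 * card S'"
    using S' S card_mono[OF fS S'(1)] by (intro expansion) auto
  ultimately show False using xY card_Y by linarith
qed

lemma planted_in_Q: "planted w \<in> Q"
  by (auto simp: planted_def Q_def)

lemma planted_onto:
  assumes b: "b \<in> Q" and S: "finite S" "card S \<le> s0"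
  shows "\<exists>w\<subseteq>U. \<forall>j\<in>S. planted w j = b j"
proof -
  define S1 where "S1 = S \<inter> {..<m}"
  have "card S1 \<le> s0" using S card_mono[of S S1] by (auto simp: S1_def)
  then have "\<exists>w\<subseteq>U. \<forall>\<rho>\<in>S1 \<times> {..<k}. odd (card (w \<inter> W \<rho>)) \<longleftrightarrow> \<rho> \<in> {(j, i). i \<in> b j}"
    using S by (intro parity_system_solvable finite_U rows_independent[of S1]) (auto simp: S1_def)
  then obtain w where w: "w \<subseteq> U"
    "\<And>j i. j \<in> S1 \<Longrightarrow> i < k \<Longrightarrow> odd (card (w \<inter> W (j, i))) \<longleftrightarrow> i \<in> b j" by force
  have "planted w j = b j" if "j \<in> S" for j
  proof (cases "j < m")
    case True
    then have "b j \<subseteq> {..<k}" using b by (auto simp: Q_def PiE_def Pi_def)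
    then show ?thesis using w(2)[of j] True that by (auto simp: planted_def S1_def)
  next
    case False
    then have "b j = undefined" using b unfolding Q_def by (intro PiE_arb) auto
    then show ?thesis using False by (simp add: planted_def)
  qed
  then show ?thesis using w(1) by blast
qed

lemma planted_sym_diff:
  assumes "w \<subseteq> U" "w' \<subseteq> U" "j < m"
  shows "planted (sym_diff w w') j = sym_diff (planted w j) (planted w' j)"
proof -
  have "finite w" "finite w'" using assms finite_U finite_subset by blast+
  then show ?thesis
    using assms(3) by (auto simp: planted_def even_card_sym_diff)
qed

text \<open>
  Translating the seed by a preimage of \<open>b\<close> adds \<open>b\<close> to the planted shifts on \<open>S\<close>; averaging over all
  \<open>b\<close> turns the planted distribution into the uniform one.
\<close>

lemma locally_uniform:
  fixes \<phi> :: "(nat \<Rightarrow> nat set) \<Rightarrow> real"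
  assumes S: "finite S" "card S \<le> s0"
    and \<phi>: "\<And>b b'. (\<And>j. j \<in> S \<Longrightarrow> b j = b' j) \<Longrightarrow> \<phi> b = \<phi> b'"
  shows "(\<Sum>w\<in>Pow U. \<phi> (planted w)) * real (card Q) = (\<Sum>b\<in>Q. \<phi> b) * real (card (Pow U))"
proof -
  define xor where "xor b b' = (\<lambda>j\<in>{..<m}. sym_diff (b j) (b' j))" for b b' :: "nat \<Rightarrow> nat set"
  have xor_Q: "xor b b' \<in> Q" if "b \<in> Q" "b' \<in> Q" for b b'
    using that unfolding Q_def xor_def PiE_def Pi_def by auto
  have xor_xor: "xor c (xor c b) = b" if "b \<in> Q" for b c
    using that by (auto simp: xor_def Q_def PiE_def extensional_def fun_eq_iff)
  have shift_b: "(\<Sum>b\<in>Q. \<phi> (xor c b)) = (\<Sum>b\<in>Q. \<phi> b)" if "c \<in> Q" for c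
    by (rule sum.reindex_bij_witness[where i = "xor c" and j = "xor c"])
       (use that xor_Q xor_xor in auto)
  have shift_w: "(\<Sum>w\<in>Pow U. \<phi> (planted w)) = (\<Sum>w\<in>Pow U. \<phi> (xor (planted w) b))" if "b \<in> Q" for b
  proof -
    obtain w0 where w0: "w0 \<subseteq> U" "\<And>j. j \<in> S \<Longrightarrow> planted w0 j = b j"
      using planted_onto[OF \<open>b \<in> Q\<close> S] by blast
    have "(\<Sum>w\<in>Pow U. \<phi> (planted w)) = (\<Sum>w\<in>Pow U. \<phi> (planted (sym_diff w w0)))"
      by (rule sum.reindex_bij_witness[where i = "\<lambda>w. sym_diff w w0" and j = "\<lambda>w. sym_diff w w0"])
         (use w0 in \<open>auto intro!: arg_cong[where f = "\<lambda>w. \<phi> (planted w)"]\<close>)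
    also have "\<dots> = (\<Sum>w\<in>Pow U. \<phi> (xor (planted w) b))"
    proof (intro sum.cong refl \<phi>)
      fix w j assume "w \<in> Pow U" "j \<in> S"
      then show "planted (sym_diff w w0) j = xor (planted w) b j"
        using planted_sym_diff[of w w0 j] w0
        by (cases "j < m") (simp add: xor_def, simp add: xor_def planted_def)
    qed
    finally show ?thesis .
  qed
  have "(\<Sum>w\<in>Pow U. \<phi> (planted w)) * real (card Q) = (\<Sum>b\<in>Q. \<Sum>w\<in>Pow U. \<phi> (xor (planted w) b))"
  proof -
    have "(\<Sum>b\<in>Q. \<Sum>w\<in>Pow U. \<phi> (xor (planted w) b)) = (\<Sum>b\<in>Q. \<Sum>w\<in>Pow U. \<phi> (planted w))"
      by (intro sum.cong refl shift_w[symmetric])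
    then show ?thesis by (simp add: mult.commute)
  qed
  also have "\<dots> = (\<Sum>w\<in>Pow U. \<Sum>b\<in>Q. \<phi> (xor (planted w) b))" by (rule sum.swap)
  also have "\<dots> = (\<Sum>b\<in>Q. \<phi> b) * real (card (Pow U))"
    by (simp add: shift_b planted_in_Q mult.commute)
  finally show ?thesis .
qed

section \<open>Independent sets under planted and under random shifts\<close>

lemma planted_independent_set:
  assumes w: "w \<subseteq> U" and n: "m * L \<le> n"
  shows "m \<le> max_independent_set n (edges (planted w))"
proof -
  \<comment> \<open>In each constraint the seed's own pattern \<open>A j\<close> is chosen. It
    cancels the pattern part of the planted shift; the values left are those of the seed's
    assignment, so the chosen vertices never conflict.\<close>
  define A where "A j = {l. Inr (j, l) \<in> w}" for j
  have A: "A j \<in> Pow {..<r}" for j using w by (auto simp: A_def U_def)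
  then have "\<exists>a<L. e a = A j" for j
    using e by (metis bij_betw_imp_surj_on imageE lessThan_iff)
  then obtain a where a: "\<And>j. a j < L" "\<And>j. e (a j) = A j" by metis
  define I where "I = (\<lambda>j. j * L + a j) ` {..<m}"
  have div: "(j * L + a j) div L = j" "(j * L + a j) mod L = a j" for j using a(1)[of j] by simp_all
  have less: "j * L + a j < m * L" if "j < m" for j
  proof -
    have "j * L + a j < Suc j * L" using a(1)[of j] by simp
    also have "\<dots> \<le> m * L" using that by (intro mult_le_mono1) simp
    finally show ?thesis .
  qed
  have fw: "finite w" using w finite_U finite_subset by blast
  have val: "val (planted w) (j * L + a j) i \<longleftrightarrow> Inl (x (j, i)) \<in> w" if "j < m" "i < k" for i j
  proof -
    have fv: "finite (v i)" using v(1)[OF that(2)] finite_subset by blast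
    have "w \<inter> W (j, i) = (if Inl (x (j, i)) \<in> w then {Inl (x (j, i))} else {}) \<union> (\<lambda>l. Inr (j, l)) ` (A j \<inter> v i)"
      by (auto simp: W_def A_def)
    then have "card (w \<inter> W (j, i)) = (if Inl (x (j, i)) \<in> w then 1 else 0) + card (A j \<inter> v i)"
      using fv by (simp add: card_image inj_on_def card_insert_if image_iff)
    then have "i \<in> planted w j \<longleftrightarrow> (Inl (x (j, i)) \<in> w) \<noteq> odd (card (A j \<inter> v i))"
      using that by (auto simp: planted_def)
    then show ?thesis by (auto simp: val_def div a)
  qed
  have "independent_set n (edges (planted w)) I"
    unfolding independent_set_def
  proof (intro conjI ballI)
    show "I \<subseteq> {..<n}" using less n by (force simp: I_def)
    fix p q assume "p \<in> I" "q \<in> I"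
    then obtain j j' where j: "p = j * L + a j" "q = j' * L + a j'" "j < m" "j' < m"
      by (auto simp: I_def)
    have "p div L = j" "q div L = j'" using div j by simp_all
    moreover have "val (planted w) p i \<longleftrightarrow> Inl (x (j, i)) \<in> w" "val (planted w) q i \<longleftrightarrow> Inl (x (j', i)) \<in> w"
      if "i < k" for i using val j that by simp_all
    ultimately have "\<not> conflict (planted w) p q"
      unfolding conflict_def using j by metis
    then show "{p, q} \<notin> edges (planted w)" by (simp add: edges_iff)
  qed
  moreover have "card I = m"
  proof -
    have "inj_on (\<lambda>j. j * L + a j) {..<m}" by (rule inj_onI) (metis div(1))
    then show ?thesis unfolding I_def by (simp add: card_image)
  qed
  ultimately show ?thesis using card_le_max_independent_set by metis
qed

text \<open>The values at an independent set define one assignment \<open>X\<close>, which satisfies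
  every constraint represented in the set, and each is represented once. The
  \<open>n - m * L\<close> isolated padding vertices are counted separately.\<close>

lemma max_independent_set_le_sat:
  assumes few: "\<And>X. X \<subseteq> vars \<Longrightarrow> card {j. j < m \<and> sat X j (b j)} \<le> t"
  shows "max_independent_set n (edges b) \<le> t + (n - m * L)"
proof (rule max_independent_set_le)
  fix S assume S: "independent_set n (edges b) S"
  define I where "I = S \<inter> {..<m * L}"
  define X where "X = {x (u div L, i) | u i. u \<in> I \<and> i < k \<and> val b u i}"
  have no_conflict: "\<not> conflict b u u'" if "u \<in> I" "u' \<in> I" for u u'
    using S that by (auto simp: I_def independent_set_def edges_iff)
  have "X \<subseteq> vars" using div_less by (auto simp: X_def vars_def I_def)
  have X: "val b u i \<longleftrightarrow> x (u div L, i) \<in> X" if u: "u \<in> I" and i: "i < k" for u i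
  proof
    assume "x (u div L, i) \<in> X"
    then obtain u' i' where u': "u' \<in> I" "i' < k" "val b u' i'" "x (u div L, i) = x (u' div L, i')"
      by (auto simp: X_def)
    show "val b u i"
    proof (cases "u = u'")
      case True
      \<comment> \<open>A vertex has no conflict with itself, so two positions of one constraint
        holding the same variable could disagree; \<open>x_inj\<close> excludes this.\<close>
      then have "i = i'" using u' i u div_less by (intro x_inj[of "u div L"]) (auto simp: I_def)
      then show ?thesis using u' True by simp
    next
      case False
      then show ?thesis using no_conflict[OF u u'(1)] u' i unfolding conflict_def by blast
    qed
  qed (use u i in \<open>auto simp: X_def\<close>)
  have "inj_on (\<lambda>u. u div L) I"
    using no_conflict unfolding conflict_def by (intro inj_onI) blast
  then have "card I = card ((\<lambda>u. u div L) ` I)" by (simp add: card_image)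
  also have "\<dots> \<le> card {j. j < m \<and> sat X j (b j)}"
  proof (rule card_mono)
    have "sat X (u div L) (b (u div L))" if "u \<in> I" for u
      unfolding sat_def using X[OF that] by (intro exI[of _ "u mod L"]) (auto simp: val_def)
    then show "(\<lambda>u. u div L) ` I \<subseteq> {j. j < m \<and> sat X j (b j)}"
      using div_less by (auto simp: I_def)
  qed simp
  also have "\<dots> \<le> t" using few \<open>X \<subseteq> vars\<close> by blast
  finally have "card I \<le> t" .
  have "card S \<le> card (I \<union> {m * L..<n})"
    using S by (intro card_mono) (auto simp: I_def independent_set_def)
  also have "\<dots> \<le> card I + card {m * L..<n}" by (rule card_Un_le)
  finally show "card S \<le> t + (n - m * L)" using \<open>card I \<le> t\<close> by simp
qed

text \<open>Once the assignment is fixed, the satisfying pattern \<open>a\<close> determines the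
  shift \<open>B\<close>.\<close>

lemma card_sat: "card {B \<in> Pow {..<k}. sat X j B} \<le> L"
proof -
  have "{B \<in> Pow {..<k}. sat X j B} \<subseteq>
      (\<lambda>a. {i. i < k \<and> (odd (card (e a \<inter> v i)) \<noteq> (x (j, i) \<in> X))}) ` {..<L}"
  proof
    fix B assume B: "B \<in> {B \<in> Pow {..<k}. sat X j B}"
    then obtain a where "a < L" "\<And>i. i < k \<Longrightarrow> ((i \<in> B) \<noteq> odd (card (e a \<inter> v i))) \<longleftrightarrow> x (j, i) \<in> X"
      by (auto simp: sat_def)
    then show "B \<in> (\<lambda>a. {i. i < k \<and> (odd (card (e a \<inter> v i)) \<noteq> (x (j, i) \<in> X))}) ` {..<L}"
      using B by (intro image_eqI[of _ _ a]) auto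
  qed
  then have "card {B \<in> Pow {..<k}. sat X j B} \<le> card {..<L}"
    by (rule surj_card_le[rotated]) simp
  then show ?thesis by simp
qed

text \<open>An exponential moment of the number of satisfied constraints. The shifts are chosen
  independently, so the sum over \<open>Q\<close> factors over the constraints.\<close>

lemma sum_two_power_sat: "(\<Sum>b\<in>Q. 2 ^ card {j. j < m \<and> sat X j (b j)}) \<le> ((2::nat) ^ k + L) ^ m"
proof -
  have "(\<Sum>b\<in>Q. 2 ^ card {j. j < m \<and> sat X j (b j)}) =
      (\<Sum>b\<in>Q. \<Prod>j<m. if sat X j (b j) then 2 else (1::nat))"
  proof (rule sum.cong)
    fix b
    have "(\<Prod>j<m. if sat X j (b j) then 2 else (1::nat)) = (\<Prod>j\<in>{j \<in> {..<m}. sat X j (b j)}. 2)"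
      by (simp only: prod.inter_filter[OF finite_lessThan])
    then show "2 ^ card {j. j < m \<and> sat X j (b j)} = (\<Prod>j<m. if sat X j (b j) then 2 else (1::nat))"
      by simp
  qed simp
  also have "\<dots> = (\<Prod>j<m. \<Sum>B\<in>Pow {..<k}. if sat X j B then 2 else 1)"
    unfolding Q_def by (subst prod_sum_PiE) auto
  also have "\<dots> \<le> (\<Prod>j<m. 2 ^ k + L)"
  proof (rule prod_mono, safe)
    fix j
    have "(\<Sum>B\<in>Pow {..<k}. if sat X j B then 2 else 1) =
        (\<Sum>B\<in>Pow {..<k}. 1 + (if sat X j B then 1 else (0::nat)))"
      by (rule sum.cong) auto
    also have "\<dots> = 2 ^ k + card {B \<in> Pow {..<k}. sat X j B}"
    proof -
      have "card {B \<in> Pow {..<k}. sat X j B} = (\<Sum>B\<in>Pow {..<k}. if sat X j B then 1 else 0)"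
        unfolding card_eq_sum by (rule sum.inter_filter) simp
      then show ?thesis by (simp only: sum.distrib) (simp add: card_Pow)
    qed
    also have "\<dots> \<le> 2 ^ k + L" using card_sat by simp
    finally show "(\<Sum>B\<in>Pow {..<k}. if sat X j B then 2 else 1) \<le> 2 ^ k + L" .
  qed
  finally show ?thesis by simp
qed

lemma finite_Q: "finite Q"
  unfolding Q_def by (intro finite_PiE) auto

lemma card_Q: "card Q = 2 ^ (k * m)"
  unfolding Q_def by (simp add: card_PiE card_Pow power_mult)

definition bad :: "(nat \<Rightarrow> nat set) set" where
  "bad = {b \<in> Q. \<exists>X\<subseteq>vars. 6 * V < card {j. j < m \<and> sat X j (b j)}}"

text \<open>Markov's inequality for \<open>2 ^ count X b\<close> and a union bound over
  \<open>X\<close>. By \<open>m_eq\<close> the mean is at most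
  \<open>(1 + L / 2 ^ k) ^ m \<le> 3 ^ V\<close>; there are at most \<open>4 ^ V\<close>
  assignments, and exceeding \<open>6 * V\<close> costs a factor \<open>64 ^ V\<close>. The bad
  fraction is thus at most \<open>(12 / 64) ^ V \<le> 1 / 4\<close>.\<close>

lemma card_bad:
  assumes V: "0 < V"
  shows "4 * card bad \<le> card Q"
proof -
  define count where "count X b = card {j. j < m \<and> sat X j (b j)}" for X b
  have fv: "finite vars" by (simp add: vars_def)
  have bound: "real ((2 ^ k + L) ^ m) \<le> 3 ^ V * real (card Q)"
  proof -
    have "real ((2 ^ k + L) ^ m) = (2 ^ k * (1 + real L / 2 ^ k)) ^ m"
      by (simp add: distrib_left)
    also have "\<dots> = real (card Q) * (1 + real L / 2 ^ k) ^ m"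
      by (simp add: power_mult_distrib card_Q power_mult)
    also have "\<dots> \<le> real (card Q) * exp (real L / 2 ^ k) ^ m"
      by (intro mult_left_mono power_mono exp_ge_add_one_self) simp_all
    also have "exp (real L / 2 ^ k) ^ m = exp (real (m * L) / 2 ^ k)"
      by (simp flip: exp_of_nat_mult)
    also have "\<dots> = exp (real V)" unfolding m_eq by simp
    also have "\<dots> = exp 1 ^ V" by (simp flip: exp_of_nat_mult)
    also have "\<dots> \<le> 3 ^ V" by (intro power_mono exp_le) simp
    finally have "real ((2 ^ k + L) ^ m) \<le> real (card Q) * 3 ^ V" by (simp add: mult_left_mono)
    then show ?thesis by (simp only: mult.commute)
  qed
  have fbad: "finite bad" using finite_Q by (simp add: bad_def)
  have "64 ^ V * card bad = (\<Sum>b\<in>bad. 2 ^ (6 * V))"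
    by (simp add: power_mult)
  also have "\<dots> \<le> (\<Sum>b\<in>bad. \<Sum>X\<in>Pow vars. 2 ^ count X b)"
  proof (rule sum_mono)
    fix b assume "b \<in> bad"
    then obtain X where X: "X \<in> Pow vars" "6 * V < count X b" by (auto simp: bad_def count_def)
    then have "(2::nat) ^ (6 * V) \<le> 2 ^ count X b" by (intro power_increasing) auto
    also have "\<dots> \<le> (\<Sum>X\<in>Pow vars. 2 ^ count X b)"
      using X(1) fv by (intro member_le_sum[of X "Pow vars" "\<lambda>X. 2 ^ count X b"]) auto
    finally show "(2::nat) ^ (6 * V) \<le> (\<Sum>X\<in>Pow vars. 2 ^ count X b)" .
  qed
  also have "\<dots> \<le> (\<Sum>b\<in>Q. \<Sum>X\<in>Pow vars. 2 ^ count X b)"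
    using finite_Q by (intro sum_mono2) (auto simp: bad_def)
  also have "\<dots> = (\<Sum>X\<in>Pow vars. \<Sum>b\<in>Q. 2 ^ count X b)" by (rule sum.swap)
  also have "\<dots> \<le> (\<Sum>X\<in>Pow vars. (2 ^ k + L) ^ m)"
    unfolding count_def by (intro sum_mono sum_two_power_sat)
  also have "\<dots> = 2 ^ card vars * (2 ^ k + L) ^ m" using fv by (simp add: card_Pow)
  also have "\<dots> \<le> 2 ^ (2 * V) * (2 ^ k + L) ^ m"
    using few_vars by (intro mult_right_mono power_increasing) (auto simp: vars_def)
  finally have "real (64 ^ V * card bad) \<le> real (2 ^ (2 * V) * (2 ^ k + L) ^ m)"
    by (simp only: of_nat_le_iff)
  also have "\<dots> \<le> 4 ^ V * (3 ^ V * real (card Q))"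
    using bound by (simp add: power_mult)
  finally have weighted: "4 ^ V * 16 ^ V * real (card bad) \<le> 12 ^ V * real (card Q)"
    by (simp flip: power_mult_distrib mult.assoc)
  have "4 * real (card bad) \<le> 4 ^ V * real (card bad)"
    using V self_le_power[of "4::real" V] by (intro mult_right_mono) auto
  then have "16 ^ V * (4 * real (card bad)) \<le> 16 ^ V * (4 ^ V * real (card bad))"
    by (intro mult_left_mono) auto
  also have "\<dots> = 4 ^ V * 16 ^ V * real (card bad)" by simp
  also note weighted
  also have "12 ^ V * real (card Q) \<le> 16 ^ V * real (card Q)"
    by (intro mult_right_mono power_mono) auto
  finally have "16 ^ V * (4 * real (card bad)) \<le> 16 ^ V * real (card Q)" .
  then have "4 * real (card bad) \<le> real (card Q)" by simp
  then show ?thesis by linarith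
qed

text \<open>The distinguishing event is an output of at least \<open>m\<close>. It has probability
  at least 2/3 on planted instances. Outside \<open>bad\<close>, \<open>gap\<close> puts every valid
  output below \<open>m\<close>, so the uniform average is at most 1/3 + 1/4 = 7/12. But
  \<open>fool\<close> makes the two averages equal.\<close>

lemma no_approximation_algorithm:
  assumes V: "0 < V" and n: "m * L \<le> n" and d: "k * D * L \<le> d"
    and \<alpha>: "0 \<le> \<alpha>" and gap: "\<alpha> * real (6 * V + (n - m * L)) + \<beta> < real m"
    and few: "\<And>E inc T. (E, inc) \<in> instances n d \<Longrightarrow> T \<in> set_pmf A \<Longrightarrow> k * D * num_queries inc T \<le> s0"
  shows "\<not> approximation_algorithm n d \<alpha> \<beta> A"
proof
  assume A: "approximation_algorithm n d \<alpha> \<beta> A"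
  define \<psi> :: "real \<Rightarrow> real" where "\<psi> y = indicator {real m..} y" for y
  define pr where "pr b = measure_pmf.prob A {T. real m \<le> result (inc b) T}" for b
  let ?opt = "\<lambda>b. real (max_independent_set n (edges b))"
  have inst: "(edges b, inc b) \<in> instances n d" for b
    using simple[OF n] incidence degree[of n b] d
    by (auto simp: instances_def degree_bound_def intro: le_trans)
  have approx: "2 / 3 \<le> measure_pmf.prob A {T. approximation \<alpha> \<beta> (?opt b) (result (inc b) T)}" for b
    using A inst[of b] unfolding approximation_algorithm_def by auto
  have pr_expectation: "pr b = (\<integral>T. \<psi> (result (inc b) T) \<partial>A)" for b
  proof -
    have "(\<integral>T. \<psi> (result (inc b) T) \<partial>A) = (\<integral>T. indicator {T. real m \<le> result (inc b) T} T \<partial>A)"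
      by (rule Bochner_Integration.integral_cong) (auto simp: \<psi>_def indicator_def)
    then show ?thesis by (simp add: pr_def)
  qed
  have integ: "integrable A (\<lambda>T. \<psi> (result (inc b) T))" for b
    by (rule measure_pmf.integrable_const_bound[of _ 1]) (auto simp: \<psi>_def indicator_def)
  have fool: "(\<Sum>w\<in>Pow U. \<psi> (result (inc (planted w)) T)) * real (card Q) =
      (\<Sum>b\<in>Q. \<psi> (result (inc b) T)) * real (card (Pow U))" if "T \<in> set_pmf A" for T
  proof -
    \<comment> \<open>At the root nothing has been revealed: the weight is 1 and
      \<open>S = {}\<close>.\<close>
    have "(\<Sum>w\<in>Pow U. 1 * \<psi> (result (inc (planted w)) T)) * real (card Q) =
        (\<Sum>b\<in>Q. 1 * \<psi> (result (inc b) T)) * real (card (Pow U))"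
    proof (rule decision_tree_indistinguishable[where q = s0 and N = nbrs and t = "k * D" and S = "{}"])
      show "card {} + k * D * num_queries (inc b) T \<le> s0" for b
        using few[OF inst that] by simp
      show "(\<Sum>w\<in>Pow U. \<phi> (planted w)) * real (card Q) = (\<Sum>b\<in>Q. \<phi> b) * real (card (Pow U))"
        if "finite S" "card S \<le> s0" "\<And>b b'. (\<And>j. j \<in> S \<Longrightarrow> b j = b' j) \<Longrightarrow> \<phi> b = \<phi> b'"
        for S and \<phi> :: "(nat \<Rightarrow> nat set) \<Rightarrow> real"
        by (rule locally_uniform[OF that])
      show "inc b u = inc b' u" if "\<And>j. j \<in> nbrs u \<Longrightarrow> b j = b' j" for u b b'
        by (rule inc_cong[OF that])
    qed (simp_all add: finite_U finite_Q planted_in_Q finite_nbrs card_nbrs)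
    then show ?thesis by simp
  qed
  have "(\<Sum>w\<in>Pow U. pr (planted w)) * real (card Q) =
      (\<integral>T. (\<Sum>w\<in>Pow U. \<psi> (result (inc (planted w)) T)) * real (card Q) \<partial>A)"
    using integ by (simp add: pr_expectation)
  also have "\<dots> = (\<integral>T. (\<Sum>b\<in>Q. \<psi> (result (inc b) T)) * real (card (Pow U)) \<partial>A)"
    by (rule integral_cong_AE) (use fool in \<open>auto simp: AE_measure_pmf_iff\<close>)
  also have "\<dots> = (\<Sum>b\<in>Q. pr b) * real (card (Pow U))"
    using integ by (simp add: pr_expectation)
  finally have eq: "(\<Sum>w\<in>Pow U. pr (planted w)) * real (card Q) = (\<Sum>b\<in>Q. pr b) * real (card (Pow U))" .
  have "2 / 3 \<le> pr (planted w)" if "w \<in> Pow U" for w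
  proof -
    have "real m \<le> ?opt (planted w)" using planted_independent_set[of w n] that n by simp
    then have "{T. approximation \<alpha> \<beta> (?opt (planted w)) (result (inc (planted w)) T)} \<subseteq>
        {T. real m \<le> result (inc (planted w)) T}"
      by (auto simp: approximation_def)
    then show ?thesis
      unfolding pr_def by (intro order_trans[OF approx] measure_pmf.finite_measure_mono) auto
  qed
  then have "(\<Sum>w\<in>Pow U. 2 / 3) \<le> (\<Sum>w\<in>Pow U. pr (planted w))" by (rule sum_mono)
  then have yes: "2 / 3 * real (card (Pow U)) \<le> (\<Sum>w\<in>Pow U. pr (planted w))" by simp
  have "pr b \<le> 1 / 3 + indicator bad b" if "b \<in> Q" for b
  proof (cases "b \<in> bad")
    case True
    have "pr b \<le> 1" by (simp add: pr_def)
    then show ?thesis using True by simp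
  next
    case False
    then have "max_independent_set n (edges b) \<le> 6 * V + (n - m * L)"
      using that by (intro max_independent_set_le_sat) (auto simp: bad_def not_less)
    then have "\<alpha> * ?opt b + \<beta> \<le> \<alpha> * real (6 * V + (n - m * L)) + \<beta>"
      using \<alpha> by (intro add_right_mono mult_left_mono) (auto simp del: of_nat_add)
    then have "{T. real m \<le> result (inc b) T} \<subseteq> - {T. approximation \<alpha> \<beta> (?opt b) (result (inc b) T)}"
      using gap by (auto simp: approximation_def)
    then have "pr b \<le> measure_pmf.prob A (- {T. approximation \<alpha> \<beta> (?opt b) (result (inc b) T)})"
      unfolding pr_def by (intro measure_pmf.finite_measure_mono) auto
    also have "\<dots> = 1 - measure_pmf.prob A {T. approximation \<alpha> \<beta> (?opt b) (result (inc b) T)}"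
      using measure_pmf.prob_compl[of "{T. approximation \<alpha> \<beta> (?opt b) (result (inc b) T)}" A]
      by (simp add: Compl_eq_Diff_UNIV)
    also have "\<dots> \<le> 1 / 3" using approx[of b] by simp
    finally show ?thesis using False by simp
  qed
  then have "(\<Sum>b\<in>Q. pr b) \<le> (\<Sum>b\<in>Q. 1 / 3 + indicator bad b)" by (rule sum_mono)
  also have "\<dots> = real (card Q) / 3 + real (card bad)"
  proof -
    have "Q \<inter> bad = bad" by (auto simp: bad_def)
    then have "(\<Sum>b\<in>Q. indicator bad b :: real) = real (card bad)"
      using finite_Q by (simp add: indicator_def sum.If_cases)
    then show ?thesis by (simp add: sum.distrib)
  qed
  also have "\<dots> \<le> real (card Q) * (7 / 12)" using card_bad[OF V] by simp
  finally have no: "(\<Sum>b\<in>Q. pr b) \<le> real (card Q) * (7 / 12)" .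
  have pos: "0 < real (card (Pow U)) * real (card Q)" using finite_U by (simp add: card_Pow card_Q)
  have "2 / 3 * real (card (Pow U)) * real (card Q) \<le> real (card Q) * (7 / 12) * real (card (Pow U))"
    using mult_right_mono[OF yes, of "real (card Q)"] mult_right_mono[OF no, of "real (card (Pow U))"] eq
    by linarith
  then have "2 / 3 * (real (card (Pow U)) * real (card Q)) \<le> 7 / 12 * (real (card (Pow U)) * real (card Q))"
    by (simp add: mult_ac)
  then show False using pos by linarith
qed

end

subsection \<open>The lower bound\<close>

text \<open>Tagging by position leaves at most \<open>k * V\<close> variables and splitting adds at
  most \<open>k * D * V div D\<close>, again \<open>k * V\<close>. Hence the parameter
  \<open>V\<close> of the locale becomes \<open>k * V\<close>, and \<open>m_eq\<close> then dictates
  the value of \<open>D\<close>.\<close>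

lemma parity_csp_exists:
  assumes k: "2 \<le> k" and r: "1 \<le> r" "r \<le> k" "k \<le> 2 ^ (r - 1)" and V: "0 < V"
    and D: "D = k * 2 ^ (k - r)" and s0: "s0 = V div (12 * D * 3 ^ k * k\<^sup>2)"
  shows "\<exists>(x :: nat \<times> nat \<Rightarrow> (nat \<times> nat) \<times> nat) v e. parity_csp k r (D * V) (k * V) s0 D x v e"
proof -
  have D0: "0 < D" using k D by simp
  let ?A = "{..<D * V} \<times> {..<k}"
  have "12 * D * 3 ^ k * k\<^sup>2 * s0 \<le> V" unfolding s0 by (rule times_div_less_eq_dividend)
  then obtain x0 :: "nat \<times> nat \<Rightarrow> nat" where x0: "x0 ` ?A \<subseteq> {..<V}"
    and exp0: "\<And>S. S \<subseteq> {..<D * V} \<Longrightarrow> S \<noteq> {} \<Longrightarrow> card S \<le> s0 \<Longrightarrow>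
      k * card S < card (x0 ` (S \<times> {..<k})) + 2 * card S"
    using expander_exists[OF k V _ D0] by blast
  \<comment> \<open>Tagging with the position rules out repeated variables within a constraint.\<close>
  define x1 where "x1 \<rho> = (snd \<rho>, x0 \<rho>)" for \<rho> :: "nat \<times> nat"
  have "x1 ` ?A \<subseteq> {..<k} \<times> {..<V}" using x0 by (auto simp: x1_def)
  then have card_x1: "card (x1 ` ?A) \<le> k * V"
    by (metis card_cartesian_product card_lessThan card_mono finite_SigmaI finite_lessThan)
  obtain y :: "nat \<times> nat \<Rightarrow> (nat \<times> nat) \<times> nat" where y: "\<And>\<rho>. \<rho> \<in> ?A \<Longrightarrow> fst (y \<rho>) = x1 \<rho>"
    and card_y: "card (y ` ?A) \<le> card (x1 ` ?A) + card ?A div D"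
    and fib: "\<And>z. card {\<rho> \<in> ?A. y \<rho> = z} \<le> D"
    using bounded_fiber_refinement[OF _ D0, of ?A x1] by blast
  obtain e where e: "bij_betw e {..<2 ^ r :: nat} (Pow {..<r :: nat})"
    using finite_same_card_bij[of "{..<2 ^ r :: nat}" "Pow {..<r}"] by (auto simp: card_Pow)
  \<comment> \<open>There are \<open>2 ^ (r - 1)\<close> subsets of \<open>{..<r}\<close> containing
    0, enough for \<open>k\<close> distinct sets \<open>v i\<close>.\<close>
  have "inj_on (insert 0) (Pow {1..<r})"
    by (rule inj_onI) (subst (asm) insert_ident, auto)
  then have "card (insert 0 ` Pow {1..<r}) = 2 ^ (r - 1)"
    by (simp add: card_image card_Pow)
  then obtain v where v: "v ` {..<k} \<subseteq> insert 0 ` Pow {1..<r}" "inj_on v {..<k}"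
    using card_le_inj[of "{..<k}" "insert 0 ` Pow {1..<r}"] r by auto
  have "parity_csp k r (D * V) (k * V) s0 D y v e"
  proof
    show "0 < k" using k by simp
    show "v i \<subseteq> {..<r}" "0 \<in> v i" if "i < k" for i
    proof -
      have "v i \<in> insert 0 ` Pow {1..<r}" using v(1) that by auto
      then show "v i \<subseteq> {..<r}" "0 \<in> v i" using r by force+
    qed
    show "k * card S < card (y ` (S \<times> {..<k})) + 2 * card S"
      if S: "S \<subseteq> {..<D * V}" "S \<noteq> {}" "card S \<le> s0" for S
    proof -
      have "finite S" using S finite_subset by blast
      \<comment> \<open>\<open>x0\<close> factors through \<open>y\<close>, so a set of constraints
        sees at least as many variables after the refinement.\<close>
      have "x0 \<rho> = snd (fst (y \<rho>))" if "\<rho> \<in> S \<times> {..<k}" for \<rho>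
        using y[of \<rho>] that S by (auto simp: x1_def)
      then have "x0 ` (S \<times> {..<k}) = (\<lambda>z. snd (fst z)) ` y ` (S \<times> {..<k})"
        unfolding image_image by (rule image_cong[OF refl])
      then have "card (x0 ` (S \<times> {..<k})) \<le> card (y ` (S \<times> {..<k}))"
        using \<open>finite S\<close> by (simp add: card_image_le)
      then show ?thesis using exp0[OF S] by simp
    qed
    have "card ?A div D = k * V" using D0 by (simp add: card_cartesian_product)
    then show "card (y ` ?A) \<le> 2 * (k * V)" using card_y card_x1 by linarith
    show "i = i'" if "j < D * V" "i < k" "i' < k" "y (j, i) = y (j, i')" for j i i'
    proof -
      have "(j, i) \<in> ?A" "(j, i') \<in> ?A" using that by auto
      then have "x1 (j, i) = x1 (j, i')" using y that(4) by metis
      then show ?thesis by (simp add: x1_def)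
    qed
    have "(2::nat) ^ (k - r) * 2 ^ r = 2 ^ k" using r by (simp flip: power_add)
    then show "D * V * 2 ^ r = k * V * 2 ^ k" by (simp add: D)
  qed (use v e fib in auto)
  then show ?thesis by blast
qed

lemma linear_query_lower_bound:
  fixes k r d :: nat and \<epsilon> :: real
  assumes k: "2 \<le> k" and r: "1 \<le> r" "r \<le> k" "k \<le> 2 ^ (r - 1)" and d: "k\<^sup>2 * 2 ^ k \<le> d"
    and \<epsilon>: "0 < \<epsilon>" "\<epsilon> < 1 / (4 * 2 ^ r)"
  shows "\<exists>c>0. \<forall>\<^sub>F n in sequentially. \<forall>A.
    approximation_algorithm n d (2 ^ k / (24 * 2 ^ r)) (\<epsilon> * real n) A \<longrightarrow>
    ereal (c * real n) \<le> ereal_of_enat (query_complexity n d A)"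
proof -
  define D where "D = k * 2 ^ (k - r)"
  define K where "K = 12 * D * 3 ^ k * k\<^sup>2"
  define N where "N = k * 2 ^ k"
  \<comment> \<open>Up to rounding, \<open>V\<close> is \<open>n / N\<close> and the fooling radius
    \<open>s0\<close> is \<open>V / K\<close>, while each query reveals at most \<open>k * D\<close>
    shifts. The factor 2 absorbs the rounding once \<open>4 * N * K \<le> n\<close>.\<close>
  define c where "c = 1 / (2 * real N * real K * real (k * D))"
  have pos: "0 < D" "0 < K" "0 < N" using k by (simp_all add: D_def K_def N_def)
  have c: "0 < c" using pos k by (simp add: c_def)
  have pow: "(2::nat) ^ (k - r) * 2 ^ r = 2 ^ k" using r by (simp flip: power_add)
  have lower: "ereal (c * real n) \<le> ereal_of_enat (query_complexity n d A)"
    if n: "4 * N * K \<le> n" "N * 2 ^ k \<le> n"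
      and A: "approximation_algorithm n d (2 ^ k / (24 * 2 ^ r)) (\<epsilon> * real n) A" for n A
  proof (rule ccontr)
    assume "\<not> ?thesis"
    then have less: "ereal_of_enat (query_complexity n d A) < ereal (c * real n)" by simp
    define V where "V = n div N"
    define s0 where "s0 = V div K"
    have V: "2 ^ k \<le> V" unfolding V_def using n(2) pos by (simp add: less_eq_div_iff_mult_less_eq mult.commute)
    then have "0 < V" by (metis less_le_trans zero_less_numeral zero_less_power)
    have nV: "N * V \<le> n" "n < N * V + N"
      unfolding V_def using pos dividend_less_times_div[of N n] by auto
    obtain x :: "nat \<times> nat \<Rightarrow> (nat \<times> nat) \<times> nat" and v e
      where csp: "parity_csp k r (D * V) (k * V) s0 D x v e"
      using parity_csp_exists[OF k r \<open>0 < V\<close> D_def] s0_def unfolding K_def by blast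
    interpret parity_csp k r "D * V" "k * V" s0 D x v e by (fact csp)
    have mL: "D * V * 2 ^ r = N * V" unfolding D_def N_def by (simp flip: pow)
    have "\<not> approximation_algorithm n d (2 ^ k / (24 * 2 ^ r)) (\<epsilon> * real n) A"
    proof (rule no_approximation_algorithm)
      show "0 < k * V" using \<open>0 < V\<close> k by simp
      show "D * V * 2 ^ r \<le> n" using nV by (simp only: mL)
      have "k * D * 2 ^ r = k\<^sup>2 * 2 ^ k" unfolding D_def by (simp add: power2_eq_square flip: pow)
      then show "k * D * 2 ^ r \<le> d" using d by simp
      show "0 \<le> 2 ^ k / (24 * (2::real) ^ r)" by simp
      \<comment> \<open>The random side is at most \<open>6 * k * V + N \<le> 7 * k * V\<close>,
        which the ratio turns into 7/24 of \<open>D * V\<close>. As \<open>n \<le> 2 * N * V\<close>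
        and \<open>N = D * 2 ^ r\<close>, the additive error stays below 1/2 of
        \<open>D * V\<close>, and 7/24 + 1/2 < 1.\<close>
      show "2 ^ k / (24 * 2 ^ r) * real (6 * (k * V) + (n - D * V * 2 ^ r)) + \<epsilon> * real n < real (D * V)"
      proof -
        define q :: real where "q = 2 ^ (k - r)"
        have q: "2 ^ k = q * 2 ^ r" unfolding q_def using r by (simp flip: power_add)
        have Dq: "real D = real k * q" by (simp add: D_def q_def)
        have q0: "0 < q" by (simp add: q_def)
        have "real (n - D * V * 2 ^ r) \<le> real N" using nV mL by linarith
        also have "real N \<le> real k * real V"
          unfolding N_def of_nat_mult using V by (intro mult_left_mono) (metis of_nat_le_iff of_nat_numeral of_nat_power, simp)
        finally have "real (6 * (k * V) + (n - D * V * 2 ^ r)) \<le> 7 * (real k * real V)"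
          by (simp add: mult.commute)
        then have "q / 24 * real (6 * (k * V) + (n - D * V * 2 ^ r)) \<le> q / 24 * (7 * (real k * real V))"
          by (rule mult_left_mono) (use q0 in simp)
        moreover have "2 ^ k / (24 * 2 ^ r) = q / 24" by (simp add: q)
        ultimately have "2 ^ k / (24 * 2 ^ r) * real (6 * (k * V) + (n - D * V * 2 ^ r)) \<le>
            7 / 24 * (q * (real k * real V))"
          by (simp only:)
        moreover have "\<epsilon> * real n < real (D * V) / 2"
        proof -
          have "real n \<le> real (2 * (N * V))" 
          proof -
            have "N \<le> N * V" using \<open>0 < V\<close> by simp
            then show ?thesis using nV by linarith
          qed
          then have "\<epsilon> * real n \<le> \<epsilon> * real (2 * (N * V))" using \<epsilon> by (intro mult_left_mono) auto
          also have "\<dots> < 1 / (4 * 2 ^ r) * real (2 * (N * V))"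
            using \<epsilon> pos \<open>0 < V\<close> by (intro mult_strict_right_mono) auto
          also have "\<dots> = real (D * V) / 2" by (simp add: N_def Dq q)
          finally show ?thesis .
        qed
        moreover have "real (D * V) = q * (real k * real V)" by (simp add: Dq)
        moreover have "0 < q * (real k * real V)" using q0 k \<open>0 < V\<close> by simp
        ultimately show ?thesis by linarith
      qed
      show "k * D * num_queries inc T \<le> s0" if inst: "(E, inc) \<in> instances n d" and T: "T \<in> set_pmf A" for E inc T
      proof -
        have "enat (num_queries inc T) \<le> (SUP T \<in> set_pmf A. enat (num_queries inc T))"
          using T by (rule SUP_upper)
        also have "\<dots> \<le> query_complexity n d A"
          unfolding query_complexity_def
          using SUP_upper[OF inst, of "\<lambda>(E, inc). SUP T \<in> set_pmf A. enat (num_queries inc T)"] by simp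
        finally have "ereal_of_enat (enat (num_queries inc T)) \<le> ereal_of_enat (query_complexity n d A)"
          by (simp only: ereal_of_enat_le_iff)
        also note less
        finally have "real (num_queries inc T) < c * real n" by simp
        then have "real (k * D) * real (num_queries inc T) \<le> real (k * D) * (c * real n)"
          by (intro mult_left_mono) auto
        also have "\<dots> = real n / (2 * (real N * real K))" using pos k by (simp add: c_def)
        also have "\<dots> \<le> real n / (real N * real K) - 2"
        proof -
          have "real (4 * N * K) \<le> real n" using n(1) by (simp only: of_nat_le_iff)
          then show ?thesis using pos by (simp add: field_simps)
        qed
        also have "\<dots> \<le> real s0"
        proof -
          have "V < K * s0 + K" using dividend_less_times_div[OF pos(2), of V] by (simp add: s0_def)
          then have "V + 1 \<le> K * (s0 + 1)" by simp
          then have "N * (V + 1) \<le> N * (K * (s0 + 1))" by (rule mult_le_mono2)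
          then have "n \<le> N * K * (s0 + 1)" using nV by (simp add: algebra_simps)
          then have "real n \<le> real (N * K * (s0 + 1))" by (simp only: of_nat_le_iff)
          then have "real n / (real N * real K) \<le> real s0 + 1"
            using pos by (simp add: divide_le_eq algebra_simps)
          then show ?thesis by simp
        qed
        finally have "real (k * D * num_queries inc T) \<le> real s0" by simp
        then show ?thesis by (simp only: of_nat_le_iff)
      qed
    qed
    then show False using A by blast
  qed
  have "\<forall>\<^sub>F n in sequentially. 4 * N * K \<le> n \<and> N * 2 ^ k \<le> n"
    by (intro eventually_conj eventually_ge_at_top)
  then have "\<forall>\<^sub>F n in sequentially. \<forall>A.
    approximation_algorithm n d (2 ^ k / (24 * 2 ^ r)) (\<epsilon> * real n) A \<longrightarrow>
    ereal (c * real n) \<le> ereal_of_enat (query_complexity n d A)"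
    by (rule eventually_mono) (use lower in blast)
  then show ?thesis using c by blast
qed

text \<open>
  For small \<open>d\<close> the ratio \<open>f d\<close> may be below 1, and then no algorithm exists at all.
\<close>

lemma no_algorithm_small_ratio:
  assumes "\<alpha> \<le> 1 / 2" "\<epsilon> < 1 / 2" "0 < n"
  shows "\<not> approximation_algorithm n d \<alpha> (\<epsilon> * real n) A"
proof
  assume "approximation_algorithm n d \<alpha> (\<epsilon> * real n) A"
  moreover have "({}, \<lambda>_. []) \<in> instances n d"
    by (simp add: instances_def simple_graph_def degree_bound_def incidence_lists_def)
  ultimately have "2 / 3 \<le> measure_pmf.prob A
      {T. approximation \<alpha> (\<epsilon> * real n) (real (max_independent_set n {})) (result (\<lambda>_. []) T)}"
    unfolding approximation_algorithm_def by auto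
  moreover have "\<not> approximation \<alpha> (\<epsilon> * real n) (real (max_independent_set n {})) y" for y
  proof
    let ?o = "real (max_independent_set n {})"
    assume "approximation \<alpha> (\<epsilon> * real n) ?o y"
    then have "?o \<le> \<alpha> * ?o + \<epsilon> * real n" by (simp add: approximation_def)
    also have "\<alpha> * ?o \<le> 1 / 2 * ?o" using assms by (intro mult_right_mono) auto
    also have "\<epsilon> * real n < 1 / 2 * real n" using assms by (intro mult_strict_right_mono) auto
    finally have "?o < real n" by simp
    moreover have "independent_set n {} {..<n}" by (simp add: independent_set_def)
    then have "n \<le> max_independent_set n {}" using card_le_max_independent_set by fastforce
    ultimately show False by simp
  qed
  ultimately show False by simp
qed

section \<open>Choice of the parameters and the final ratio\<close>

lemma csp_parameters:
  assumes "16 \<le> d"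
  shows "\<exists>k r. 2 \<le> k \<and> 1 \<le> r \<and> r \<le> k \<and> k \<le> 2 ^ (r - 1) \<and> k\<^sup>2 * 2 ^ k \<le> d \<and>
    d < (k + 1)\<^sup>2 * 2 ^ (k + 1) \<and> 2 ^ r \<le> 4 * (k::nat)"
proof -
  define P where "P k \<longleftrightarrow> k\<^sup>2 * 2 ^ k \<le> d" for k :: nat
  have bound: "k \<le> d" if "P k" for k
  proof (cases "k = 0")
    case False
    have "k < 2 ^ k" by (rule less_exp)
    also have "\<dots> \<le> k\<^sup>2 * 2 ^ k" using False by simp
    finally show ?thesis using that by (simp add: P_def)
  qed simp
  have P2: "P 2" using assms by (simp add: P_def)
  \<comment> \<open>Maximality of \<open>k\<close> keeps \<open>d\<close> close to
    \<open>k\<^sup>2 * 2 ^ k\<close>, so that \<open>2 ^ k\<close> is \<open>d\<close> up to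
    polylogarithmic factors.\<close>
  define k where "k = Greatest P"
  have "P k" unfolding k_def by (rule GreatestI_nat[where P = P, OF P2 bound])
  then have k: "k\<^sup>2 * 2 ^ k \<le> d" by (simp only: P_def)
  have k2: "2 \<le> k" unfolding k_def by (rule Greatest_le_nat[where P = P, OF P2 bound])
  have "\<not> P (k + 1)"
  proof
    assume "P (k + 1)"
    then have "k + 1 \<le> k" unfolding k_def by (rule Greatest_le_nat[where P = P, OF _ bound])
    then show False by simp
  qed
  then have d: "d < (k + 1)\<^sup>2 * 2 ^ (k + 1)" by (simp only: P_def not_le)
  \<comment> \<open>This is the logarithm of \<open>k\<close> rounded up; the witness is
    \<open>r + 1\<close>, because one coordinate of the code is spent on the common element
    0.\<close>
  define r where "r = (LEAST s. k \<le> 2 ^ s)"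
  have kr: "k \<le> 2 ^ r" unfolding r_def by (rule LeastI[of _ k]) (simp add: less_imp_le less_exp)
  have "k \<le> 2 ^ (k - 1)" using less_exp[of "k - 1"] by linarith
  then have "r \<le> k - 1" unfolding r_def by (rule Least_le)
  have "r \<noteq> 0" using kr k2 by (cases "r = 0") auto
  then have "\<not> k \<le> 2 ^ (r - 1)" unfolding r_def by (intro not_less_Least) (simp add: r_def)
  then have "2 * 2 ^ (r - 1) < 2 * k" by simp
  then have "2 ^ r < 2 * k" using \<open>r \<noteq> 0\<close> by (simp flip: power_Suc)
  then show ?thesis
    using k k2 d kr \<open>r \<le> k - 1\<close> by (intro exI[of _ k] exI[of _ "r + 1"]) auto
qed

text \<open>From \<open>2 ^ K d \<le> d\<close> and \<open>ln 2 \<ge> 1 / 2\<close> follows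
  \<open>K d \<le> 2 * ln d\<close>, so powers of \<open>K d\<close> are polylogarithmic.\<close>

lemma polylogI:
  assumes pos: "\<And>d. 0 < g d" and K: "\<And>d. start \<le> d \<Longrightarrow> 2 ^ K d \<le> d"
    and g: "\<And>d. start \<le> d \<Longrightarrow> g d \<le> C * real (K d) ^ c"
    and C: "0 \<le> C"
  shows "polylog g"
proof -
  have "g \<in> O(\<lambda>d. ln (real d) ^ c)"
  proof (rule bigoI)
    have "norm (g d) \<le> C * 2 ^ c * norm (ln (real d) ^ c)" if d: "max 1 start \<le> d" for d
    proof -
      have "real (K d) * ln 2 = ln (2 ^ K d)" by (simp add: ln_realpow)
      also have "\<dots> \<le> ln (real d)"
      proof -
        have "real (2 ^ K d) \<le> real d" using K d by (simp only: of_nat_le_iff)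
        then show ?thesis using d by simp
      qed
      finally have "real (K d) * ln 2 \<le> ln (real d)" .
      moreover have "1 / 2 \<le> ln (2 :: real)"
        using ln_le_minus_one[of "1 / 2 :: real"] by (simp add: ln_div)
      then have "real (K d) * (1 / 2) \<le> real (K d) * ln 2" by (rule mult_left_mono) simp
      ultimately have "real (K d) * (1 / 2) \<le> ln (real d)" by linarith
      then have "real (K d) \<le> 2 * ln (real d)" by simp
      then have "real (K d) ^ c \<le> (2 * ln (real d)) ^ c" by (rule power_mono) simp
      then have "C * real (K d) ^ c \<le> C * (2 * ln (real d)) ^ c" using C by (rule mult_left_mono)
      then have "g d \<le> C * (2 * ln (real d)) ^ c" using g[of d] d by simp
      then show ?thesis using pos[of d] d by (simp add: power_mult_distrib mult.assoc)
    qed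
    then show "\<forall>\<^sub>F d in sequentially. norm (g d) \<le> C * 2 ^ c * norm (ln (real d) ^ c)"
      by (rule eventually_sequentiallyI)
  qed
  then show ?thesis using pos by (auto simp: polylog_def)
qed

theorem theorem6:
  "\<exists>(f :: nat \<Rightarrow> real) g h.
     polylog g \<and> (\<forall>d. f d = real d / g d) \<and> polylog h \<and>
     (\<forall>(\<epsilon>::real) d. 0 < \<epsilon> \<and> \<epsilon> < 1 / h d \<longrightarrow>
        (\<exists>c>0. \<forall>\<^sub>F n in sequentially. \<forall>A.
           approximation_algorithm n d (f d) (\<epsilon> * real n) A \<longrightarrow>
           ereal (c * real n) \<le> ereal_of_enat (query_complexity n d A)))"
proof -
  obtain K R :: "nat \<Rightarrow> nat" where KR: "\<And>d. 16 \<le> d \<Longrightarrow> 2 \<le> K d \<and> 1 \<le> R d \<and> R d \<le> K d \<and>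
      K d \<le> 2 ^ (R d - 1) \<and> (K d)\<^sup>2 * 2 ^ K d \<le> d \<and> d < (K d + 1)\<^sup>2 * 2 ^ (K d + 1) \<and> 2 ^ R d \<le> 4 * K d"
    using csp_parameters by metis
  \<comment> \<open>For \<open>d \<ge> 16\<close> this makes \<open>f d\<close> the ratio of
    \<open>linear_query_lower_bound\<close>. For smaller \<open>d\<close> it gives
    \<open>f d = d / (2 * d + 1) < 1 / 2\<close>, where no algorithm exists.\<close>
  define g :: "nat \<Rightarrow> real" where
    "g d = (if d < 16 then 2 * real d + 1 else real d * 24 * 2 ^ R d / 2 ^ K d)" for d
  \<comment> \<open>The planted size is about \<open>n / 2 ^ R d\<close>, and
    \<open>\<epsilon> * n\<close> has to stay below half of it. Some cap is unavoidable: for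
    \<open>\<epsilon> \<ge> 1\<close> the constant output \<open>n\<close> is valid without any
    query.\<close>
  define h :: "nat \<Rightarrow> real" where "h d = (if d < 16 then 2 else 4 * 2 ^ R d)" for d
  define f where "f d = real d / g d" for d
  have K: "2 ^ K d \<le> d" if "16 \<le> d" for d
  proof -
    have "1 * 2 ^ K d \<le> (K d)\<^sup>2 * 2 ^ K d" using KR[OF that] by (intro mult_le_mono1) simp
    then show ?thesis using KR[OF that] by linarith
  qed
  have R: "(2::real) ^ R d \<le> 4 * real (K d)" if "16 \<le> d" for d
  proof -
    have "real (2 ^ R d) \<le> real (4 * K d)" using KR[OF that] by (simp only: of_nat_le_iff)
    then show ?thesis by simp
  qed
  have "polylog h"
  proof (rule polylogI[where start = 16 and K = K and C = 16 and c = 1])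
    show "h d \<le> 16 * real (K d) ^ 1" if "16 \<le> d" for d using R[OF that] that by (simp add: h_def)
  qed (use K in \<open>auto simp: h_def\<close>)
  moreover have "polylog g"
  proof (rule polylogI[where start = 16 and K = K and C = 768 and c = 3])
    show "g d \<le> 768 * real (K d) ^ 3" if d: "16 \<le> d" for d
    proof -
      have "real d \<le> real ((K d + 1)\<^sup>2 * 2 ^ (K d + 1))"
        using KR[OF d] by (simp only: of_nat_le_iff) simp
      also have "\<dots> = (real (K d) + 1)\<^sup>2 * 2 * 2 ^ K d" by (simp add: add.commute)
      also have "\<dots> \<le> (2 * real (K d))\<^sup>2 * 2 * 2 ^ K d"
        using KR[OF d] by (intro mult_right_mono power_mono) auto
      finally have "real d * (24 * 2 ^ R d / 2 ^ K d) \<le>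
          ((2 * real (K d))\<^sup>2 * 2 * 2 ^ K d) * (24 * (4 * real (K d)) / 2 ^ K d)"
        using R[OF d] by (intro mult_mono divide_right_mono) auto
      also have "\<dots> = 768 * real (K d) ^ 3" by (simp add: power2_eq_square power3_eq_cube)
      finally show ?thesis using d by (simp add: g_def)
    qed
  qed (use K in \<open>auto simp: g_def\<close>)
  moreover have "\<exists>c>0. \<forall>\<^sub>F n in sequentially. \<forall>A.
      approximation_algorithm n d (f d) (\<epsilon> * real n) A \<longrightarrow>
      ereal (c * real n) \<le> ereal_of_enat (query_complexity n d A)"
    if \<epsilon>: "0 < \<epsilon>" "\<epsilon> < 1 / h d" for \<epsilon> d
  proof (cases "d < 16")
    case True
    then have "f d \<le> 1 / 2" "\<epsilon> < 1 / 2" using \<epsilon> by (auto simp: f_def g_def h_def field_simps)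
    then have "\<forall>\<^sub>F n in sequentially. \<forall>A. \<not> approximation_algorithm n d (f d) (\<epsilon> * real n) A"
      using no_algorithm_small_ratio by (intro eventually_sequentiallyI[of 1]) auto
    then show ?thesis by (intro exI[of _ 1] conjI) (auto elim: eventually_mono)
  next
    case False
    then have "f d = 2 ^ K d / (24 * 2 ^ R d)" by (simp add: f_def g_def)
    then show ?thesis
      using linear_query_lower_bound[of "K d" "R d" d \<epsilon>] KR[of d] False \<epsilon> by (simp add: h_def)
  qed
  ultimately show ?thesis using f_def by blast
qed

end
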